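(* Let $\mathbf g\in E$. Then $E^*_{\mathbf g}\mathbb{T}E^*_{\mathbf g}/\mathbb{I}_{\mathbf g}$ is isomorphic as an $\mathbb{F}$-algebra to the direct sum of $N_{\mathbf g}$ copies of $\mathrm{M}_1(\mathbb{F})$, where $N_{\mathbf g}=2^{|\{a\in S(\mathbf g):\ |U_a|>2,\ p\nmid |U_a|-1\}|}$. Moreover $\mathrm{Rad}(E^*_{\mathbf g}\mathbb{T}E^*_{\mathbf g})=\mathbb{I}_{\mathbf g}$, and the nilpotent index of $\mathrm{Rad}(E^*_{\mathbf g}\mathbb{T}E^*_{\mathbf g})$ equals $|\{a\in S(\mathbf g): p\mid |U_a|-1\}|+1$.
   Context: Let $\mathbb{F}$ be a field of characteristic $p\ge 0$; for a positive integer $m$, "$p\mid m$" means that the image of $m$ in $\mathbb{F}$ is zero. Let $n\ge 1$ and let $U_1,\dots,U_n$ be finite sets with $|U_h|\ge 2$. Put $X=U_1\times\cdots\times U_n$ and $E=\{0,1\}^n$. For $\mathbf g\in E$ let $S(\mathbf g)=\{a:\mathbf g_a=1\}$. For $V\subseteq\{1,\dots,n\}$ let $V^\circ=\{a\in V:|U_a|>2\}$. Let $R_{\mathbf g}=\{(\mathbf y,\mathbf z)\in X\times X:\ \mathbf y_a\neq\mathbf z_a\iff\mathbf g_a=1\}$ and $k_{\mathbf g}=\prod_{a\in S(\mathbf g)}(|U_a|-1)$ ($k_{\mathbf 0}=1$). Let $A_{\mathbf g}\in\mathrm{M}_X(\mathbb{F})$ be the $\{0,1\}$ adjacency matrix of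 $R_{\mathbf g}$. Fix $\mathbf x\in X$ and let $E^*_{\mathbf g}$ be the diagonal matrix with $(\mathbf y,\mathbf y)$-entry $1$ iff $(\mathbf x,\mathbf y)\in R_{\mathbf g}$, else $0$. $\mathbb{T}$ is the $\mathbb{F}$-subalgebra of $\mathrm{M}_X(\mathbb{F})$ generated by all $A_{\mathbf g},E^*_{\mathbf g}$; $E^*_{\mathbf g}\mathbb{T}E^*_{\mathbf g}$ is an $\mathbb{F}$-algebra with identity $E^*_{\mathbf g}$. Let $\mathbb{P}$ be the set of $(\mathbf a,\mathbf b,\mathbf c)\in E^3$ with $S(\mathbf a)\triangle S(\mathbf c)\subseteq S(\mathbf b)\subseteq(S(\mathbf a)\triangle S(\mathbf c))\cup(S(\mathbf a)\cap S(\mathbf c))^\circ$. For $(\mathbf g,\mathbf h,\mathbf i)\in\mathbb{P}$ let $B_{\mathbf g,\mathbf h,\mathbf i}=\sum_{\mathbf j}E^*_{\mathbf g}A_{\mathbf j}E^*_{\mathbf i}$ over all $\mathbf j\in E$ with $S(\mathbf g)\triangle S(\mathbf i)\subseteq S(\mathbf j)\subseteq S(\mathbf h)$. Let $\mathbb{I}_{\mathbf g}$ be the $\mathbb{F}$-span of $\{B_{\mathbf g,\mathbf a,\mathbf g}:(\mathbf g,\mathbf a,\mathbf g)\in\mathbb{P},\ p\mid k_{\mathbf a}\}$ (a two-sided ideal of $E^*_{\mathbf g}\mathbb{T}E^*_{\mathbf g}$). The nilpotent index of a nilpotent ideal is the least $m\ge 1$ such that all products of $m$ of its elements vanish. *)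

theory Defs
  imports "HOL-Algebra.QuotRing" "HOL-Algebra.Subrings" "HOL-Algebra.Module" "HOL-Library.Function_Algebras"
begin

text \<open>
  An algebra over a field (a type of class \<^class>\<open>field\<close>) is given by a record
  of type \<open>('f, 'm) module\<close> of HOL-Algebra: a ring together with a scalar multiplication.
\<close>

definition is_subalgebra :: "('f, 'm) module \<Rightarrow> 'm set \<Rightarrow> bool" where
  "is_subalgebra A S \<longleftrightarrow> subring S A \<and> (\<forall>c. \<forall>s\<in>S. c \<odot>\<^bsub>A\<^esub> s \<in> S)"

definition generated_subalgebra :: "('f, 'm) module \<Rightarrow> 'm set \<Rightarrow> 'm set" where
  "generated_subalgebra A G = is_subalgebra A hull G"

text \<open>The scalar multiplication on cosets follows the pattern of \<^const>\<open>rcoset_mult\<close>: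
  for an ideal \<open>I\<close> that is a subspace, \<open>c \<odot> (I + a) = I + c \<odot> a\<close>.\<close>

definition quotient_algebra :: "('f, 'm) module \<Rightarrow> 'm set \<Rightarrow> ('f, 'm set) module" where
  "quotient_algebra A I =
    \<lparr>carrier = carrier (A Quot I), monoid.mult = monoid.mult (A Quot I), monoid.one = monoid.one (A Quot I),
     ring.zero = ring.zero (A Quot I), ring.add = ring.add (A Quot I),
     module.smult = (\<lambda>c C. \<Union>a\<in>C. I +>\<^bsub>A\<^esub> (c \<odot>\<^bsub>A\<^esub> a))\<rparr>"

definition direct_sum_copies :: "nat \<Rightarrow> ('f, 'm) module \<Rightarrow> ('f, nat \<Rightarrow> 'm) module" where
  "direct_sum_copies N A =
    \<lparr>carrier = {..<N} \<rightarrow>\<^sub>E carrier A,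
     monoid.mult = (\<lambda>v w. \<lambda>i\<in>{..<N}. v i \<otimes>\<^bsub>A\<^esub> w i),
     monoid.one = (\<lambda>i\<in>{..<N}. \<one>\<^bsub>A\<^esub>),
     ring.zero = (\<lambda>i\<in>{..<N}. \<zero>\<^bsub>A\<^esub>),
     ring.add = (\<lambda>v w. \<lambda>i\<in>{..<N}. v i \<oplus>\<^bsub>A\<^esub> w i),
     module.smult = (\<lambda>c v. \<lambda>i\<in>{..<N}. c \<odot>\<^bsub>A\<^esub> v i)\<rparr>"

definition algebra_iso :: "('f, 'm) module \<Rightarrow> ('f, 'k) module \<Rightarrow> ('m \<Rightarrow> 'k) set" where
  "algebra_iso A B =
    {h \<in> ring_iso A B. \<forall>c. \<forall>a\<in>carrier A. h (c \<odot>\<^bsub>A\<^esub> a) = c \<odot>\<^bsub>B\<^esub> h a}"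

definition algebra_isomorphic :: "('f, 'm) module \<Rightarrow> ('f, 'k) module \<Rightarrow> bool" where
  "algebra_isomorphic A B \<longleftrightarrow> algebra_iso A B \<noteq> {}"

definition left_ideal :: "'m set \<Rightarrow> ('m, 'r) ring_scheme \<Rightarrow> bool" where
  "left_ideal J R \<longleftrightarrow> additive_subgroup J R \<and> (\<forall>a\<in>carrier R. \<forall>x\<in>J. a \<otimes>\<^bsub>R\<^esub> x \<in> J)"

definition maximal_left_ideal :: "'m set \<Rightarrow> ('m, 'r) ring_scheme \<Rightarrow> bool" where
  "maximal_left_ideal M R \<longleftrightarrow> left_ideal M R \<and> M \<noteq> carrier R \<and>
    (\<forall>J. left_ideal J R \<and> M \<subseteq> J \<longrightarrow> J = M \<or> J = carrier R)"

definition jacobson_radical :: "('m, 'r) ring_scheme \<Rightarrow> 'm set" where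
  "jacobson_radical R = carrier R \<inter> \<Inter>{M. maximal_left_ideal M R}"

definition products_vanish :: "('m, 'r) ring_scheme \<Rightarrow> 'm set \<Rightarrow> nat \<Rightarrow> bool" where
  "products_vanish R I m \<longleftrightarrow>
    (\<forall>xs. length xs = m \<and> set xs \<subseteq> I \<longrightarrow> foldr (\<otimes>\<^bsub>R\<^esub>) xs \<one>\<^bsub>R\<^esub> = \<zero>\<^bsub>R\<^esub>)"

definition nilpotent_ideal :: "('m, 'r) ring_scheme \<Rightarrow> 'm set \<Rightarrow> bool" where
  "nilpotent_ideal R I \<longleftrightarrow> ideal I R \<and> (\<exists>m\<ge>1. products_vanish R I m)"

definition nilpotent_index :: "('m, 'r) ring_scheme \<Rightarrow> 'm set \<Rightarrow> nat" where
  "nilpotent_index R I = (LEAST m. m \<ge> 1 \<and> products_vanish R I m)"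

text \<open>A matrix with rows and columns indexed by \<open>X\<close> is a function that vanishes
  outside \<open>X \<times> X\<close>.  Sums of matrices are the pointwise ones, but the
  pointwise product of functions is not the matrix product.\<close>

type_synonym ('x, 'f) matrix = "'x \<Rightarrow> 'x \<Rightarrow> 'f"

definition mat_scale :: "'f \<Rightarrow> ('x, 'f::field) matrix \<Rightarrow> ('x, 'f) matrix" where
  "mat_scale c M = (\<lambda>y z. c * M y z)"

definition mat_algebra :: "'x set \<Rightarrow> ('f::field, ('x, 'f) matrix) module" where
  "mat_algebra X =
    \<lparr>carrier = {M. \<forall>y z. y \<notin> X \<or> z \<notin> X \<longrightarrow> M y z = 0},
     monoid.mult = (\<lambda>M N y z. \<Sum>w\<in>X. M y w * N w z),
     monoid.one = (\<lambda>y z. if y = z \<and> y \<in> X then 1 else 0),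
     ring.zero = 0,
     ring.add = (+),
     module.smult = mat_scale\<rparr>"

definition points :: "nat \<Rightarrow> (nat \<Rightarrow> 'u set) \<Rightarrow> (nat \<Rightarrow> 'u) set" where
  "points n U = (\<Pi>\<^sub>E a\<in>{1..n}. U a)"

definition E_set :: "nat \<Rightarrow> (nat \<Rightarrow> nat) set" where
  "E_set n = {1..n} \<rightarrow>\<^sub>E {0, 1}"

definition supp :: "nat \<Rightarrow> (nat \<Rightarrow> nat) \<Rightarrow> nat set" where
  "supp n g = {a \<in> {1..n}. g a = 1}"

definition big_part :: "(nat \<Rightarrow> 'u set) \<Rightarrow> nat set \<Rightarrow> nat set" where
  "big_part U V = {a \<in> V. card (U a) > 2}"

definition R_rel ::
  "nat \<Rightarrow> (nat \<Rightarrow> 'u set) \<Rightarrow> (nat \<Rightarrow> nat) \<Rightarrow> ((nat \<Rightarrow> 'u) \<times> (nat \<Rightarrow> 'u)) set" where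
  "R_rel n U g =
    {(y, z) \<in> points n U \<times> points n U. \<forall>a\<in>{1..n}. y a \<noteq> z a \<longleftrightarrow> g a = 1}"

definition k_val :: "nat \<Rightarrow> (nat \<Rightarrow> 'u set) \<Rightarrow> (nat \<Rightarrow> nat) \<Rightarrow> nat" where
  "k_val n U g = (\<Prod>a\<in>supp n g. card (U a) - 1)"

definition A_mat ::
  "nat \<Rightarrow> (nat \<Rightarrow> 'u set) \<Rightarrow> (nat \<Rightarrow> nat) \<Rightarrow> (nat \<Rightarrow> 'u, 'f::field) matrix" where
  "A_mat n U g = (\<lambda>y z. if (y, z) \<in> R_rel n U g then 1 else 0)"

definition Estar ::
  "nat \<Rightarrow> (nat \<Rightarrow> 'u set) \<Rightarrow> (nat \<Rightarrow> 'u) \<Rightarrow> (nat \<Rightarrow> nat) \<Rightarrow> (nat \<Rightarrow> 'u, 'f::field) matrix" where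
  "Estar n U x g = (\<lambda>y z. if y = z \<and> (x, y) \<in> R_rel n U g then 1 else 0)"

definition T_alg ::
  "nat \<Rightarrow> (nat \<Rightarrow> 'u set) \<Rightarrow> (nat \<Rightarrow> 'u) \<Rightarrow> (nat \<Rightarrow> 'u, 'f::field) matrix set" where
  "T_alg n U x =
    generated_subalgebra (mat_algebra (points n U))
      (A_mat n U ` E_set n \<union> Estar n U x ` E_set n)"

definition triple_prod ::
  "nat \<Rightarrow> (nat \<Rightarrow> 'u set) \<Rightarrow> (nat \<Rightarrow> 'u, 'f::field) matrix \<Rightarrow> (nat \<Rightarrow> 'u, 'f) matrix \<Rightarrow>
    (nat \<Rightarrow> 'u, 'f) matrix \<Rightarrow> (nat \<Rightarrow> 'u, 'f) matrix" where
  "triple_prod n U L M N =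
    (L \<otimes>\<^bsub>mat_algebra (points n U)\<^esub> M) \<otimes>\<^bsub>mat_algebra (points n U)\<^esub> N"

text \<open>The algebra \<open>E\<^sup>*\<^sub>g T E\<^sup>*\<^sub>g\<close>, whose identity is \<open>E\<^sup>*\<^sub>g\<close>.\<close>

definition corner_algebra ::
  "nat \<Rightarrow> (nat \<Rightarrow> 'u set) \<Rightarrow> (nat \<Rightarrow> 'u) \<Rightarrow> (nat \<Rightarrow> nat) \<Rightarrow>
    ('f::field, (nat \<Rightarrow> 'u, 'f) matrix) module" where
  "corner_algebra n U x g = (mat_algebra (points n U))
    \<lparr>carrier := (\<lambda>M. triple_prod n U (Estar n U x g) M (Estar n U x g)) ` T_alg n U x,
     monoid.one := Estar n U x g\<rparr>"

definition P_set ::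
  "nat \<Rightarrow> (nat \<Rightarrow> 'u set) \<Rightarrow> ((nat \<Rightarrow> nat) \<times> (nat \<Rightarrow> nat) \<times> (nat \<Rightarrow> nat)) set" where
  "P_set n U = {(a, b, c) \<in> E_set n \<times> E_set n \<times> E_set n.
     sym_diff (supp n a) (supp n c) \<subseteq> supp n b \<and>
     supp n b \<subseteq> sym_diff (supp n a) (supp n c) \<union> big_part U (supp n a \<inter> supp n c)}"

definition B_mat ::
  "nat \<Rightarrow> (nat \<Rightarrow> 'u set) \<Rightarrow> (nat \<Rightarrow> 'u) \<Rightarrow> (nat \<Rightarrow> nat) \<Rightarrow> (nat \<Rightarrow> nat) \<Rightarrow> (nat \<Rightarrow> nat) \<Rightarrow>
    (nat \<Rightarrow> 'u, 'f::field) matrix" where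
  "B_mat n U x g h i =
    (\<Sum>j \<in> {j \<in> E_set n. sym_diff (supp n g) (supp n i) \<subseteq> supp n j \<and> supp n j \<subseteq> supp n h}.
       triple_prod n U (Estar n U x g) (A_mat n U j) (Estar n U x i))"

definition I_ideal ::
  "nat \<Rightarrow> (nat \<Rightarrow> 'u set) \<Rightarrow> (nat \<Rightarrow> 'u) \<Rightarrow> (nat \<Rightarrow> nat) \<Rightarrow>
    (nat \<Rightarrow> 'u, 'f::field) matrix set" where
  "I_ideal n U x g = module.span mat_scale
    {B_mat n U x g a g | a. (g, a, g) \<in> P_set n U \<and> of_nat (k_val n U a) = (0::'f)}"

end

theory Submission
  imports Defs "HOL-Combinatorics.Transposition"
begin

text \<open>
  The algebra \<open>T\<close> commutes with the product over \<open>a\<close> of the stabilisers of \<open>x a\<close> in \<open>Sym (U a)\<close>.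
  On the sphere \<open>{y. (x, y) \<in> R\<^sub>g}\<close> two pairs lie in the same orbit iff they differ in the same
  coordinates, so the corner consists of the matrices on the sphere whose \<open>(y, z)\<close>-entry depends
  only on the set of coordinates where \<open>y\<close> and \<open>z\<close> differ; these are the coordinates in
  \<open>S(g)\<^sup>\<circ>\<close>. By Moebius inversion the matrices \<open>b\<^sub>V = B\<^sub>g\<^sub>,\<^sub>V\<^sub>,\<^sub>g\<close> with \<open>V \<subseteq> S(g)\<^sup>\<circ>\<close> form a basis, and
  counting gives \<open>b\<^sub>V b\<^sub>W = (\<Prod>a\<in>V\<inter>W. m\<^sub>a) b\<^sub>V\<^sub>\<union>\<^sub>W\<close> with \<open>m\<^sub>a = |U a| - 1\<close>.

  For every set \<open>T\<close> of coordinates with \<open>m\<^sub>a \<noteq> 0\<close> there is a character sending \<open>b\<^sub>V\<close> to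
  \<open>\<Prod>a\<in>V. m\<^sub>a\<close> if \<open>V \<subseteq> T\<close> and to 0 otherwise. By Moebius inversion again the characters are
  jointly surjective with common kernel the span \<open>I\<close> of the \<open>b\<^sub>V\<close> such that \<open>m\<^sub>a = 0\<close> for
  some \<open>a \<in> V\<close>. A product of elements of \<open>I\<close> involves more and more coordinates with
  \<open>m\<^sub>a = 0\<close>, each at most once, so \<open>I\<close> is nilpotent; hence it is the radical.
\<close>

section \<open>Moebius inversion on finite power sets\<close>

lemma sum_Pow_insert:
  fixes f :: "'a set \<Rightarrow> 'b::comm_monoid_add"
  assumes "finite T" "a \<notin> T"
  shows "(\<Sum>V\<in>Pow (insert a T). f V) = (\<Sum>V\<in>Pow T. f V) + (\<Sum>V\<in>Pow T. f (insert a V))"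
proof -
  have "inj_on (insert a) (Pow T)"
    using assms by (auto simp: inj_on_def)
  then have "(\<Sum>V\<in>insert a ` Pow T. f V) = (\<Sum>V\<in>Pow T. f (insert a V))"
    by (simp add: sum.reindex)
  moreover have "(\<Sum>V\<in>Pow T \<union> insert a ` Pow T. f V) = (\<Sum>V\<in>Pow T. f V) + (\<Sum>V\<in>insert a ` Pow T. f V)"
    using assms by (intro sum.union_disjoint) auto
  ultimately show ?thesis
    by (simp add: Pow_insert)
qed

text \<open>The existence half of Moebius inversion, obtained without signs by adding one element at
  a time: the sets containing the new element must contribute exactly the increment
  \<open>f (insert a T) - f T\<close>, and the induction hypothesis applies to this increment as
  well.\<close>

lemma subset_sums_solvable:
  fixes f :: "'a set \<Rightarrow> 'b::ab_group_add"
  assumes "finite Y"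
  shows "\<exists>d. \<forall>T\<subseteq>Y. (\<Sum>V\<in>Pow T. d V) = f T"
  using assms
proof (induction Y arbitrary: f rule: finite_induct)
  case empty
  show ?case by (rule exI[of _ f]) simp
next
  case (insert a Y)
  obtain d1 where d1: "\<And>T. T \<subseteq> Y \<Longrightarrow> (\<Sum>V\<in>Pow T. d1 V) = f T"
    using insert.IH[of f] by blast
  obtain d2 where d2: "\<And>T. T \<subseteq> Y \<Longrightarrow> (\<Sum>V\<in>Pow T. d2 V) = f (insert a T) - f T"
    using insert.IH[of "\<lambda>T. f (insert a T) - f T"] by blast
  define d where "d V = (if a \<in> V then d2 (V - {a}) else d1 V)" for V
  have d_off: "(\<Sum>V\<in>Pow T. d V) = f T" if "T \<subseteq> Y" for T
  proof -
    have "(\<Sum>V\<in>Pow T. d V) = (\<Sum>V\<in>Pow T. d1 V)"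
      using that insert.hyps by (intro sum.cong) (auto simp: d_def)
    then show ?thesis using d1[OF that] by simp
  qed
  have d_on: "(\<Sum>V\<in>Pow T. d (insert a V)) = f (insert a T) - f T" if "T \<subseteq> Y" for T
  proof -
    have "(\<Sum>V\<in>Pow T. d (insert a V)) = (\<Sum>V\<in>Pow T. d2 V)"
    proof (intro sum.cong refl)
      fix V assume "V \<in> Pow T"
      then have "insert a V - {a} = V" using that insert.hyps by auto
      then show "d (insert a V) = d2 V" by (simp add: d_def)
    qed
    then show ?thesis using d2[OF that] by simp
  qed
  have "(\<Sum>V\<in>Pow T. d V) = f T" if T: "T \<subseteq> insert a Y" for T
  proof (cases "a \<in> T")
    case False
    then show ?thesis using T by (intro d_off) auto
  next
    case True
    define T' where "T' = T - {a}"
    have T': "T = insert a T'" "a \<notin> T'" "T' \<subseteq> Y"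
      using True T by (auto simp: T'_def)
    moreover have "finite T'" using T' insert.hyps finite_subset by blast
    ultimately show ?thesis
      by (simp add: sum_Pow_insert d_off d_on)
  qed
  then show ?case by blast
qed

text \<open>The uniqueness half: in the sum over \<open>Pow V\<close> every term except
  \<open>d V\<close> vanishes by induction over proper subsets.\<close>

lemma subset_sums_zero:
  fixes d :: "'a set \<Rightarrow> 'b::ab_group_add"
  assumes "finite Y" and zero: "\<And>T. T \<subseteq> Y \<Longrightarrow> (\<Sum>V\<in>Pow T. d V) = 0" and "V \<subseteq> Y"
  shows "d V = 0"
proof -
  have "finite V" using assms finite_subset by blast
  then show ?thesis using \<open>V \<subseteq> Y\<close>
  proof (induction V rule: finite_psubset_induct)
    case (psubset V)
    have "(\<Sum>W\<in>Pow V. d W) = d V + (\<Sum>W\<in>Pow V - {V}. d W)"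
      using psubset.hyps by (intro sum.remove) auto
    also have "(\<Sum>W\<in>Pow V - {V}. d W) = 0"
      using psubset.IH psubset.prems by (intro sum.neutral) auto
    finally show ?case using zero[OF psubset.prems] by simp
  qed
qed

lemma sum_supersets_eq_sum_Pow_complement:
  assumes "T \<subseteq> Y"
  shows "(\<Sum>V\<in>{V. T \<subseteq> V \<and> V \<subseteq> Y}. d V) = (\<Sum>V\<in>Pow (Y - T). d (Y - V))"
  using assms
  by (intro sum.reindex_bij_witness[of _ "\<lambda>V. Y - V" "\<lambda>V. Y - V"])
    (auto simp: double_diff)

text \<open>Complementation in \<open>Y\<close> exchanges subsets and supersets. The superset form
  governs matrix entries in terms of \<open>basis_mat\<close>, the subset form governs the values of
  characters.\<close>

lemma superset_sums_solvable:
  fixes f :: "'a set \<Rightarrow> 'b::ab_group_add"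
  assumes "finite Y"
  shows "\<exists>d. \<forall>T\<subseteq>Y. (\<Sum>V\<in>{V. T \<subseteq> V \<and> V \<subseteq> Y}. d V) = f T"
proof -
  obtain d where d: "\<And>T. T \<subseteq> Y \<Longrightarrow> (\<Sum>V\<in>Pow T. d V) = f (Y - T)"
    using subset_sums_solvable[OF assms, of "\<lambda>T. f (Y - T)"] by blast
  have "(\<Sum>V\<in>{V. T \<subseteq> V \<and> V \<subseteq> Y}. d (Y - V)) = f T" if T: "T \<subseteq> Y" for T
  proof -
    have "(\<Sum>V\<in>{V. T \<subseteq> V \<and> V \<subseteq> Y}. d (Y - V)) = (\<Sum>V\<in>Pow (Y - T). d (Y - (Y - V)))"
      by (rule sum_supersets_eq_sum_Pow_complement[OF T])
    also have "\<dots> = (\<Sum>V\<in>Pow (Y - T). d V)"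
      by (intro sum.cong refl arg_cong[where f = d]) auto
    also have "\<dots> = f T"
      using d[of "Y - T"] T by (simp add: double_diff)
    finally show ?thesis .
  qed
  then show ?thesis by (intro exI[of _ "\<lambda>V. d (Y - V)"]) blast
qed

lemma superset_sums_zero:
  fixes d :: "'a set \<Rightarrow> 'b::ab_group_add"
  assumes "finite Y"
    and zero: "\<And>T. T \<subseteq> Y \<Longrightarrow> (\<Sum>V\<in>{V. T \<subseteq> V \<and> V \<subseteq> Y}. d V) = 0" and "V \<subseteq> Y"
  shows "d V = 0"
proof -
  have "(\<Sum>W\<in>Pow T. d (Y - W)) = 0" if "T \<subseteq> Y" for T
    using zero[of "Y - T"] sum_supersets_eq_sum_Pow_complement[of "Y - T" Y d] that
    by (simp add: double_diff)
  then have "d (Y - (Y - V)) = 0"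
    using subset_sums_zero[OF assms(1), of "\<lambda>W. d (Y - W)" "Y - V"] by simp
  then show ?thesis using \<open>V \<subseteq> Y\<close> by (simp add: double_diff)
qed

section \<open>Quotients, direct sums and nilpotent ideals\<close>

lemma direct_sum_copies_ring:
  assumes "ring A"
  shows "ring (direct_sum_copies N A)"
proof -
  interpret ring A by fact
  show ?thesis
  proof (intro ringI abelian_groupI monoidI, goal_cases)
    \<comment> \<open>Case 6 is the existence of additive inverses, which needs a witness.\<close>
    case (6 v)
    then show ?case
      by (intro bexI[of _ "\<lambda>i\<in>{..<N}. \<ominus>\<^bsub>A\<^esub> v i"])
        (auto simp: direct_sum_copies_def fun_eq_iff PiE_iff l_neg)
  qed (auto simp: direct_sum_copies_def PiE_iff fun_eq_iff extensional_def
        a_ac m_assoc l_distr r_distr restrict_def)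
qed

text \<open>The ring part is the first isomorphism theorem. What remains is compatibility with the
  scalar multiplication, which \<open>quotient_algebra\<close> defines as a union over all
  representatives of a coset.\<close>

lemma quotient_algebra_isomorphic:
  fixes A :: "('f, 'm) module" and B :: "('f, 'k) module"
  assumes "ring A" "ring B" and h: "h \<in> ring_hom A B"
    and surj: "h ` carrier A = carrier B" and ker: "I = a_kernel A B h"
    and smult_closed: "\<And>c a. a \<in> carrier A \<Longrightarrow> c \<odot>\<^bsub>A\<^esub> a \<in> carrier A"
    and h_smult: "\<And>c a. a \<in> carrier A \<Longrightarrow> h (c \<odot>\<^bsub>A\<^esub> a) = c \<odot>\<^bsub>B\<^esub> h a"
  shows "algebra_isomorphic (quotient_algebra A I) B"
proof -
  interpret A: ring A by fact
  interpret h: ring_hom_ring A B h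
    by (rule ring_hom_ringI2[OF assms(1-3)])
  interpret I: ideal I A
    unfolding ker by (rule h.kernel_is_ideal)
  define \<phi> where "\<phi> = (\<lambda>C. the_elem (h ` C))"
  \<comment> \<open>Since \<open>h\<close> collapses a coset to one point, \<open>the_elem\<close>
    in \<open>\<phi>\<close> reads off its value.\<close>
  have coset: "h ` (I +>\<^bsub>A\<^esub> a) = {h a}" if "a \<in> carrier A" for a
  proof -
    have "h (i \<oplus>\<^bsub>A\<^esub> a) = h a" if "i \<in> I" for i
    proof -
      have "i \<in> carrier A \<and> h i = \<zero>\<^bsub>B\<^esub>"
        using that unfolding ker a_kernel_def' by blast
      then show ?thesis using \<open>a \<in> carrier A\<close> by (metis h.hom_add h.hom_closed h.S.l_zero)
    qed
    moreover have "\<exists>i. i \<in> I" using I.zero_closed by blast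
    ultimately show ?thesis
      by (auto simp: a_r_coset_def' image_iff)
  qed
  have "\<phi> \<in> ring_iso (A Quot I) B"
    unfolding \<phi>_def ker by (rule h.FactRing_iso_set[OF surj])
  then have iso: "\<phi> \<in> ring_iso (quotient_algebra A I) B"
    by (simp add: ring_iso_def ring_hom_def quotient_algebra_def)
  have "\<phi> (c \<odot>\<^bsub>quotient_algebra A I\<^esub> C) = c \<odot>\<^bsub>B\<^esub> \<phi> C"
    if C: "C \<in> carrier (quotient_algebra A I)" for c C
  proof -
    obtain a where a: "a \<in> carrier A" "C = I +>\<^bsub>A\<^esub> a"
      using C unfolding quotient_algebra_def FactRing_def A_RCOSETS_def' by auto
    have C_sub: "C \<subseteq> carrier A"
      using a by (auto simp: a_r_coset_def')
    have hC: "h b = h a" if "b \<in> C" for b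
      using coset[OF a(1)] that unfolding a(2) by blast
    have "a \<in> C"
      unfolding a(2) using I.a_rcos_self a(1) by blast
    have "h ` (\<Union>b\<in>C. I +>\<^bsub>A\<^esub> (c \<odot>\<^bsub>A\<^esub> b)) = (\<Union>b\<in>C. {c \<odot>\<^bsub>B\<^esub> h b})"
      unfolding image_UN using C_sub
      by (intro SUP_cong refl) (subst coset, auto simp: smult_closed h_smult)
    also have "\<dots> = (\<Union>b\<in>C. {c \<odot>\<^bsub>B\<^esub> h a})"
      by (intro SUP_cong refl) (subst hC, auto)
    also have "\<dots> = {c \<odot>\<^bsub>B\<^esub> h a}"
      using \<open>a \<in> C\<close> by blast
    finally show ?thesis
      using coset[OF a(1)] unfolding \<phi>_def quotient_algebra_def a(2) by simp
  qed
  then show ?thesis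
    using iso unfolding algebra_isomorphic_def algebra_iso_def by blast
qed

section \<open>Nilpotent ideals and maximal left ideals\<close>

lemma left_ideal_sum:
  assumes "ring R" "left_ideal M R" "ideal I R"
  shows "left_ideal (M <+>\<^bsub>R\<^esub> I) R"
proof -
  interpret ring R by fact
  interpret I: ideal I R by fact
  interpret M: additive_subgroup M R using assms by (simp add: left_ideal_def)
  show ?thesis
    unfolding left_ideal_def
  proof (intro conjI ballI)
    show "additive_subgroup (M <+>\<^bsub>R\<^esub> I) R"
      by (intro add_additive_subgroups M.additive_subgroup_axioms I.additive_subgroup_axioms)
  next
    fix a s assume a: "a \<in> carrier R" and "s \<in> M <+>\<^bsub>R\<^esub> I"
    then obtain m i where mi: "m \<in> M" "i \<in> I" "s = m \<oplus>\<^bsub>R\<^esub> i"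
      by (auto simp: set_add_def')
    then have "a \<otimes>\<^bsub>R\<^esub> s = a \<otimes>\<^bsub>R\<^esub> m \<oplus>\<^bsub>R\<^esub> a \<otimes>\<^bsub>R\<^esub> i"
      using a by (simp add: r_distr)
    moreover have "a \<otimes>\<^bsub>R\<^esub> m \<in> M" using assms(2) a mi by (simp add: left_ideal_def)
    ultimately show "a \<otimes>\<^bsub>R\<^esub> s \<in> M <+>\<^bsub>R\<^esub> I"
      using I.I_l_closed a mi by (auto simp: set_add_def')
  qed
qed

text \<open>Maximality leaves only \<open>M\<close> and the whole ring for the left ideal
  \<open>M + I\<close>. The whole ring is impossible: \<open>1 = m + i\<close> with \<open>i\<close>
  nilpotent would put \<open>1\<close> into \<open>M\<close>.\<close>

lemma nilpotent_ideal_subset_maximal_left_ideal: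
  assumes "ring R" "nilpotent_ideal R I" "maximal_left_ideal M R"
  shows "I \<subseteq> M"
proof -
  interpret ring R by fact
  interpret I: ideal I R using assms by (simp add: nilpotent_ideal_def)
  have M: "left_ideal M R" "M \<noteq> carrier R"
    and max: "\<And>J. left_ideal J R \<Longrightarrow> M \<subseteq> J \<Longrightarrow> J = M \<or> J = carrier R"
    using assms(3) by (auto simp: maximal_left_ideal_def)
  interpret M: additive_subgroup M R using M by (simp add: left_ideal_def)
  have absorb: "\<And>a m. a \<in> carrier R \<Longrightarrow> m \<in> M \<Longrightarrow> a \<otimes>\<^bsub>R\<^esub> m \<in> M"
    using M by (simp add: left_ideal_def)
  obtain k where k: "products_vanish R I k"
    using assms(2) by (auto simp: nilpotent_ideal_def)
  have sub: "M \<subseteq> M <+>\<^bsub>R\<^esub> I" "I \<subseteq> M <+>\<^bsub>R\<^esub> I"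
  proof -
    show "M \<subseteq> M <+>\<^bsub>R\<^esub> I"
    proof
      fix m assume "m \<in> M"
      then have "m = m \<oplus>\<^bsub>R\<^esub> \<zero>\<^bsub>R\<^esub>" by simp
      with \<open>m \<in> M\<close> I.zero_closed show "m \<in> M <+>\<^bsub>R\<^esub> I"
        unfolding set_add_def' by blast
    qed
    show "I \<subseteq> M <+>\<^bsub>R\<^esub> I"
    proof
      fix i assume "i \<in> I"
      then have "i = \<zero>\<^bsub>R\<^esub> \<oplus>\<^bsub>R\<^esub> i" by simp
      with \<open>i \<in> I\<close> M.zero_closed show "i \<in> M <+>\<^bsub>R\<^esub> I"
        unfolding set_add_def' by blast
    qed
  qed
  have "M <+>\<^bsub>R\<^esub> I \<noteq> carrier R"
  proof
    assume "M <+>\<^bsub>R\<^esub> I = carrier R"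
    then obtain m i where mi: "m \<in> M" "i \<in> I" "\<one>\<^bsub>R\<^esub> = m \<oplus>\<^bsub>R\<^esub> i"
      using one_closed unfolding set_add_def' by blast
    note carr = M.a_Hcarr[OF mi(1)] I.a_Hcarr[OF mi(2)]
    \<comment> \<open>\<open>f j\<close> is the power of \<open>i\<close> with exponent
      \<open>j\<close>, written as a fold so that \<open>products_vanish\<close> applies to it
      literally.\<close>
    define f where "f j = foldr (\<otimes>\<^bsub>R\<^esub>) (replicate j i) \<one>\<^bsub>R\<^esub>" for j
    have f_Suc: "f (Suc j) = i \<otimes>\<^bsub>R\<^esub> f j" for j
      by (simp add: f_def)
    have f0: "f 0 = \<one>\<^bsub>R\<^esub>" by (simp add: f_def)
    have f_carr: "f j \<in> carrier R" for j
      by (induction j) (simp_all add: f0 f_Suc carr)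
    have f_comm: "f j \<otimes>\<^bsub>R\<^esub> i = i \<otimes>\<^bsub>R\<^esub> f j" for j
      by (induction j) (simp_all add: f0 f_Suc carr f_carr m_assoc)
    have "f k = \<zero>\<^bsub>R\<^esub>"
      using k mi(2) unfolding products_vanish_def f_def by (metis length_replicate in_set_replicate subsetI)
    then have "f k \<in> M" by simp
    \<comment> \<open>From \<open>1 = m + i\<close> we get \<open>i\<^sup>j = i\<^sup>j m + i\<^sup>j\<^sup>+\<^sup>1\<close>, so membership in \<open>M\<close> descends to \<open>i\<^sup>0 = 1\<close>.\<close>
    moreover have "f j \<in> M" if "f (Suc j) \<in> M" for j
    proof -
      have "f j = f j \<otimes>\<^bsub>R\<^esub> (m \<oplus>\<^bsub>R\<^esub> i)"
        using mi(3) f_carr by (metis r_one)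
      also have "\<dots> = f j \<otimes>\<^bsub>R\<^esub> m \<oplus>\<^bsub>R\<^esub> f (Suc j)"
        using f_carr carr by (simp add: r_distr f_comm f_Suc)
      finally show ?thesis
        using absorb[OF f_carr mi(1)] that M.a_closed by metis
    qed
    ultimately have "f 0 \<in> M"
      by (induction k) auto
    then have "a \<in> M" if "a \<in> carrier R" for a
      using absorb[OF that] f0 that by fastforce
    then show False
      using M(2) M.a_subset by blast
  qed
  then show ?thesis
    using max[OF left_ideal_sum[OF \<open>ring R\<close> M(1) I.ideal_axioms]] sub by blast
qed

section \<open>Matrix algebras\<close>

lemma mat_algebra_simps:
  "carrier (mat_algebra X) = {M. \<forall>y z. y \<notin> X \<or> z \<notin> X \<longrightarrow> M y z = 0}"
  "M \<otimes>\<^bsub>mat_algebra X\<^esub> N = (\<lambda>y z. \<Sum>w\<in>X. M y w * N w z)"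
  "\<one>\<^bsub>mat_algebra X\<^esub> = (\<lambda>y z. if y = z \<and> y \<in> X then 1 else 0)"
  "\<zero>\<^bsub>mat_algebra X\<^esub> = 0"
  "M \<oplus>\<^bsub>mat_algebra X\<^esub> N = M + N"
  "c \<odot>\<^bsub>mat_algebra X\<^esub> M = mat_scale c M"
  by (simp_all add: mat_algebra_def)

lemma mat_mult_assoc:
  "(L \<otimes>\<^bsub>mat_algebra X\<^esub> M) \<otimes>\<^bsub>mat_algebra X\<^esub> N = L \<otimes>\<^bsub>mat_algebra X\<^esub> (M \<otimes>\<^bsub>mat_algebra X\<^esub> N)"
  unfolding mat_algebra_simps fun_eq_iff sum_distrib_left sum_distrib_right
  by (intro allI, subst sum.swap) (simp add: mult.assoc)

lemma mat_mult_distrib: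
  "(L + M) \<otimes>\<^bsub>mat_algebra X\<^esub> N = L \<otimes>\<^bsub>mat_algebra X\<^esub> N + M \<otimes>\<^bsub>mat_algebra X\<^esub> N"
  "L \<otimes>\<^bsub>mat_algebra X\<^esub> (M + N) = L \<otimes>\<^bsub>mat_algebra X\<^esub> M + L \<otimes>\<^bsub>mat_algebra X\<^esub> N"
  by (simp_all add: mat_algebra_simps fun_eq_iff algebra_simps sum.distrib)

lemma mat_mult_scale:
  "mat_scale c M \<otimes>\<^bsub>mat_algebra X\<^esub> N = mat_scale c (M \<otimes>\<^bsub>mat_algebra X\<^esub> N)"
  "M \<otimes>\<^bsub>mat_algebra X\<^esub> mat_scale c N = mat_scale c (M \<otimes>\<^bsub>mat_algebra X\<^esub> N)"
  by (simp_all add: mat_algebra_simps mat_scale_def fun_eq_iff sum_distrib_left mult_ac)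

lemma mat_algebra_ring:
  fixes X :: "'x set"
  assumes "finite X"
  shows "ring (mat_algebra X :: ('f::field, ('x, 'f) matrix) module)"
proof (intro ringI abelian_groupI monoidI, goal_cases)
  case (6 M)
  then show ?case
    by (intro bexI[of _ "- M"]) (auto simp: mat_algebra_simps)
next
  \<comment> \<open>Cases 10 and 11 are the unit laws: against the identity matrix at most one
    summand survives.\<close>
  case (10 M)
  have "(\<Sum>w\<in>X. (if y = w \<and> y \<in> X then 1 else 0) * M w z) = (\<Sum>w\<in>X. if w = y then M w z else 0)" for y z
    by (intro sum.cong) auto
  then show ?case using assms 10
    by (auto simp: mat_algebra_simps fun_eq_iff)
next
  case (11 M)
  have "(\<Sum>w\<in>X. M y w * (if w = z \<and> w \<in> X then 1 else 0)) = (\<Sum>w\<in>X. if w = z then M y w else 0)" for y z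
    by (intro sum.cong) auto
  then show ?case using assms 11
    by (auto simp: mat_algebra_simps fun_eq_iff)
qed (simp_all add: mat_mult_assoc mat_mult_distrib mat_algebra_simps(1,3-6) add_ac, auto simp: mat_algebra_simps)

lemma vector_space_mat_scale: "vector_space mat_scale"
  by unfold_locales (auto simp: mat_scale_def fun_eq_iff algebra_simps)

section \<open>Algebras with a join-multiplicative basis\<close>

text \<open>Bilinearity and associativity are assumed on the whole type \<open>'m\<close>, not only on the carrier:
  matrix multiplication as a total function on matrices has them there.\<close>

locale join_algebra = vector_space scale
  for scale :: "'f::field \<Rightarrow> 'm::ab_group_add \<Rightarrow> 'm" (infixr "*s" 75) +
  fixes A :: "('f, 'm) module" and B :: "'i set" and m :: "'i \<Rightarrow> 'f" and b :: "'i set \<Rightarrow> 'm"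
  assumes finite_B: "finite B"
    and carrier_A: "carrier A = span (b ` Pow B)"
    and add_A: "\<And>u v. u \<oplus>\<^bsub>A\<^esub> v = u + v"
    and zero_A: "\<zero>\<^bsub>A\<^esub> = 0"
    and one_A: "\<one>\<^bsub>A\<^esub> = b {}"
    and smult_A: "\<And>c v. c \<odot>\<^bsub>A\<^esub> v = c *s v"
    and mult_assoc: "\<And>u v w. (u \<otimes>\<^bsub>A\<^esub> v) \<otimes>\<^bsub>A\<^esub> w = u \<otimes>\<^bsub>A\<^esub> (v \<otimes>\<^bsub>A\<^esub> w)"
    and mult_add_left: "\<And>u v w. (u + v) \<otimes>\<^bsub>A\<^esub> w = u \<otimes>\<^bsub>A\<^esub> w + v \<otimes>\<^bsub>A\<^esub> w"
    and mult_add_right: "\<And>u v w. u \<otimes>\<^bsub>A\<^esub> (v + w) = u \<otimes>\<^bsub>A\<^esub> v + u \<otimes>\<^bsub>A\<^esub> w"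
    and mult_scale_left: "\<And>c u v. (c *s u) \<otimes>\<^bsub>A\<^esub> v = c *s (u \<otimes>\<^bsub>A\<^esub> v)"
    and mult_scale_right: "\<And>c u v. u \<otimes>\<^bsub>A\<^esub> (c *s v) = c *s (u \<otimes>\<^bsub>A\<^esub> v)"
    and mult_basis: "\<And>V W. V \<subseteq> B \<Longrightarrow> W \<subseteq> B \<Longrightarrow>
      b V \<otimes>\<^bsub>A\<^esub> b W = (\<Prod>a\<in>V \<inter> W. m a) *s b (V \<union> W)"
    and coeffs_zero: "\<And>c V. (\<Sum>V\<in>Pow B. c V *s b V) = 0 \<Longrightarrow> V \<subseteq> B \<Longrightarrow> c V = 0"
begin

text \<open>\<open>b {a}\<close> squares to \<open>m a *s b {a}\<close>, so it is nilpotent for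
  \<open>a\<close> in \<open>nil_part\<close> and a nonzero multiple of an idempotent for
  \<open>a\<close> in \<open>unit_part\<close>.\<close>

definition nil_part :: "'i set" where "nil_part = {a \<in> B. m a = 0}"

definition unit_part :: "'i set" where "unit_part = {a \<in> B. m a \<noteq> 0}"

definition nil_ideal :: "'m set" where
  "nil_ideal = span (b ` {V. V \<subseteq> B \<and> V \<inter> nil_part \<noteq> {}})"

lemma mult_zero [simp]: "0 \<otimes>\<^bsub>A\<^esub> v = 0" "v \<otimes>\<^bsub>A\<^esub> 0 = 0"
  using mult_scale_left[of 0 0 v] mult_scale_right[of v 0 0] by simp_all

text \<open>Bilinearity reduces products of spans to products of generators. Closure of the carrier,
  the ideal property and the nilpotency bound are all instances.\<close>

lemma mult_mem_span:
  assumes "u \<in> span S" "v \<in> span T" and ST: "\<And>s t. s \<in> S \<Longrightarrow> t \<in> T \<Longrightarrow> s \<otimes>\<^bsub>A\<^esub> t \<in> span R"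
  shows "u \<otimes>\<^bsub>A\<^esub> v \<in> span R"
  using assms(1)
proof (induction rule: span_induct_alt)
  case base
  show ?case by (simp add: span_zero)
next
  case (step c s u)
  have "s \<otimes>\<^bsub>A\<^esub> v \<in> span R"
    using assms(2)
  proof (induction rule: span_induct_alt)
    case base
    show ?case by (simp add: span_zero)
  next
    case (step c t v)
    then show ?case
      using ST \<open>s \<in> S\<close> by (simp add: mult_add_right mult_scale_right span_add span_scale)
  qed
  then show ?case
    using step by (simp add: mult_add_left mult_scale_left span_add span_scale)
qed

lemma basis_in_carrier: "V \<subseteq> B \<Longrightarrow> b V \<in> carrier A"
  by (auto simp: carrier_A intro: span_base)

lemma mult_closed: "u \<in> carrier A \<Longrightarrow> v \<in> carrier A \<Longrightarrow> u \<otimes>\<^bsub>A\<^esub> v \<in> carrier A"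
  unfolding carrier_A
  by (erule (1) mult_mem_span) (auto simp: mult_basis intro!: span_scale[OF span_base])

lemma one_mult: "v \<in> carrier A \<Longrightarrow> b {} \<otimes>\<^bsub>A\<^esub> v = v"
  unfolding carrier_A
  by (induction rule: span_induct_alt) (auto simp: mult_basis mult_add_right mult_scale_right)

lemma mult_one: "v \<in> carrier A \<Longrightarrow> v \<otimes>\<^bsub>A\<^esub> b {} = v"
  unfolding carrier_A
  by (induction rule: span_induct_alt) (auto simp: mult_basis mult_add_left mult_scale_left)

lemma ring_A: "ring A"
proof (intro ringI abelian_groupI monoidI, goal_cases)
  case (6 v)
  then show ?case
    by (intro bexI[of _ "- v"]) (auto simp: carrier_A add_A zero_A span_neg)
qed (simp_all add: mult_closed one_mult mult_one one_A basis_in_carrier mult_assoc,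
    simp_all add: carrier_A add_A zero_A mult_add_left mult_add_right add_ac span_zero span_add)

sublocale ring A by (rule ring_A)

lemma minus_A: "v \<in> carrier A \<Longrightarrow> \<ominus>\<^bsub>A\<^esub> v = - v"
  by (rule minus_equality) (auto simp: add_A zero_A carrier_A span_neg)

lemma subspace_additive_subgroup:
  assumes "subspace S" "S \<subseteq> carrier A"
  shows "additive_subgroup S A"
proof (rule additive_subgroupI, rule add.subgroupI)
  show "S \<noteq> {}" using assms subspace_0 by auto
  show "\<ominus>\<^bsub>A\<^esub> v \<in> S" if "v \<in> S" for v
    using minus_A[of v] that assms subspace_neg by auto
qed (use assms in \<open>auto simp: add_A subspace_add\<close>)

lemma inj_on_basis: "inj_on b (Pow B)"
proof (rule inj_onI, rule ccontr)
  fix V W assume VW: "V \<in> Pow B" "W \<in> Pow B" "b V = b W" "V \<noteq> W"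
  \<comment> \<open>These are the coefficients of the relation \<open>b V - b W = 0\<close>.\<close>
  define c where "c X = (if X = V then 1 else 0) - (if X = W then 1 else (0::'f))" for X
  have "(\<Sum>X\<in>Pow B. c X *s b X) = (\<Sum>X\<in>Pow B. if X = V then b X else 0) - (\<Sum>X\<in>Pow B. if X = W then b X else 0)"
    unfolding c_def sum_subtractf[symmetric] scale_left_diff_distrib
    by (intro sum.cong refl) auto
  also have "\<dots> = 0" using VW finite_B by simp
  finally have "c V = 0" using coeffs_zero VW by blast
  then show False using VW by (simp add: c_def)
qed

lemma independent_basis: "independent (b ` Pow B)"
proof (rule independent_if_scalars_zero)
  fix f v assume sum: "(\<Sum>v\<in>b ` Pow B. f v *s v) = 0" and "v \<in> b ` Pow B"
  then obtain V where "V \<subseteq> B" "v = b V" by auto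
  moreover have "(\<Sum>V\<in>Pow B. f (b V) *s b V) = 0"
    using sum by (simp add: sum.reindex[OF inj_on_basis])
  ultimately show "f v = 0" using coeffs_zero[of "\<lambda>V. f (b V)"] by simp
qed (simp add: finite_B)

lemma basis_nonzero: "V \<subseteq> B \<Longrightarrow> b V \<noteq> 0"
  using independent_basis dependent_zero by force

lemma carrier_coeffs:
  assumes "v \<in> carrier A"
  obtains c where "v = (\<Sum>V\<in>Pow B. c V *s b V)"
proof -
  obtain u where "v = (\<Sum>w\<in>b ` Pow B. u w *s w)"
    using assms finite_B unfolding carrier_A by (auto simp: span_finite)
  then have "v = (\<Sum>V\<in>Pow B. u (b V) *s b V)"
    by (simp add: sum.reindex[OF inj_on_basis])
  then show ?thesis by (rule that)
qed

section \<open>Characters: multiplicativity, joint kernel and joint surjectivity\<close>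

text \<open>Values on the independent basis determine a linear map on the carrier only;
  \<open>SOME\<close> fixes one extension to the whole type.\<close>

definition character :: "'i set \<Rightarrow> 'm \<Rightarrow> 'f" where
  "character T = (SOME \<chi>. Vector_Spaces.linear scale (*) \<chi> \<and>
     (\<forall>V\<subseteq>B. \<chi> (b V) = (if V \<subseteq> T then \<Prod>a\<in>V. m a else 0)))"

lemma character:
  "Vector_Spaces.linear scale (*) (character T)"
  "V \<subseteq> B \<Longrightarrow> character T (b V) = (if V \<subseteq> T then \<Prod>a\<in>V. m a else 0)"
proof -
  interpret vector_space_pair scale "(*) :: 'f \<Rightarrow> 'f \<Rightarrow> 'f"
    by unfold_locales (auto simp: algebra_simps)
  \<comment> \<open>\<open>f\<close> recovers \<open>V\<close> from the vector \<open>b V\<close>,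
    which injectivity of \<open>b\<close> on \<open>Pow B\<close> permits.\<close>
  define f where "f v = (let V = inv_into (Pow B) b v in if V \<subseteq> T then \<Prod>a\<in>V. m a else 0)" for v
  obtain \<chi> where \<chi>: "Vector_Spaces.linear scale (*) \<chi>" "\<And>v. v \<in> b ` Pow B \<Longrightarrow> \<chi> v = f v"
    using linear_independent_extend[OF independent_basis, of f] by blast
  have "\<chi> (b V) = (if V \<subseteq> T then \<Prod>a\<in>V. m a else 0)" if "V \<subseteq> B" for V
    using \<chi>(2)[of "b V"] that inv_into_f_f[OF inj_on_basis, of V] by (simp add: f_def)
  with \<chi>(1) have "\<exists>\<chi>. Vector_Spaces.linear scale (*) \<chi> \<and>
     (\<forall>V\<subseteq>B. \<chi> (b V) = (if V \<subseteq> T then \<Prod>a\<in>V. m a else 0))" by blast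
  from someI_ex[OF this]
  show "Vector_Spaces.linear scale (*) (character T)"
    "V \<subseteq> B \<Longrightarrow> character T (b V) = (if V \<subseteq> T then \<Prod>a\<in>V. m a else 0)"
    unfolding character_def by blast+
qed

lemma character_linear [simp]:
  "character T (u + v) = character T u + character T v"
  "character T (c *s v) = c * character T v"
  "character T 0 = 0"
  "character T (\<Sum>i\<in>S. f i) = (\<Sum>i\<in>S. character T (f i))"
proof -
  interpret Vector_Spaces.linear scale "(*)" "character T" by (rule character(1))
  show "character T (u + v) = character T u + character T v"
    "character T (c *s v) = c * character T v"
    "character T 0 = 0"
    "character T (\<Sum>i\<in>S. f i) = (\<Sum>i\<in>S. character T (f i))"
    by (simp_all add: add scale zero sum)
qed

text \<open>The structure constant over \<open>V \<inter> W\<close> supplies the factors that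
  \<open>V \<union> W\<close> counts only once. Both sides vanish unless \<open>V\<close> and
  \<open>W\<close> lie in \<open>T\<close>.\<close>

lemma character_mult_basis:
  assumes "V \<subseteq> B" "W \<subseteq> B"
  shows "character T (b V \<otimes>\<^bsub>A\<^esub> b W) = character T (b V) * character T (b W)"
proof -
  have "finite V" "finite W" using assms finite_B finite_subset by blast+
  then have "(\<Prod>a\<in>V \<union> W. m a) * (\<Prod>a\<in>V \<inter> W. m a) = (\<Prod>a\<in>V. m a) * (\<Prod>a\<in>W. m a)"
    by (rule prod.union_inter)
  then show ?thesis using assms by (auto simp: mult_basis character mult.commute)
qed

lemma character_mult:
  assumes "u \<in> carrier A" "v \<in> carrier A"
  shows "character T (u \<otimes>\<^bsub>A\<^esub> v) = character T u * character T v"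
  using assms(1) unfolding carrier_A
proof (induction rule: span_induct_alt)
  case base
  show ?case by simp
next
  case (step c s u)
  have "character T (s \<otimes>\<^bsub>A\<^esub> v) = character T s * character T v"
    using assms(2) unfolding carrier_A
  proof (induction rule: span_induct_alt)
    case base
    show ?case by simp
  next
    case (step c t v)
    then show ?case
      using \<open>s \<in> b ` Pow B\<close> character_mult_basis
      by (auto simp: mult_add_right mult_scale_right algebra_simps)
  qed
  then show ?case
    using step by (simp add: mult_add_left mult_scale_left algebra_simps)
qed

text \<open>Characters turn coefficients into weighted subset sums, the form in which Moebius
  inversion applies.\<close>

lemma character_sum:
  assumes "T \<subseteq> B"
  shows "character T (\<Sum>V\<in>Pow B. c V *s b V) = (\<Sum>V\<in>Pow T. c V * (\<Prod>a\<in>V. m a))"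
proof -
  have "character T (\<Sum>V\<in>Pow B. c V *s b V) = (\<Sum>V\<in>Pow B. if V \<subseteq> T then c V * (\<Prod>a\<in>V. m a) else 0)"
    by (auto simp: character intro!: sum.cong)
  also have "\<dots> = (\<Sum>V\<in>Pow T. c V * (\<Prod>a\<in>V. m a))"
    using assms finite_B by (intro sum.mono_neutral_cong_right) auto
  finally show ?thesis .
qed

lemma unit_part_subset: "unit_part \<subseteq> B"
  by (auto simp: unit_part_def)

lemma finite_parts: "finite unit_part" "finite nil_part"
  using finite_B by (auto simp: unit_part_def nil_part_def)

lemma nil_ideal_subset: "nil_ideal \<subseteq> carrier A"
  unfolding nil_ideal_def carrier_A by (rule span_mono) auto

text \<open>A set meeting \<open>nil_part\<close> is contained in no
  \<open>T \<subseteq> unit_part\<close>, which gives one direction. For the other, uniqueness of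
  inversion kills the weighted coefficients on subsets of \<open>unit_part\<close>, where the
  weights are invertible.\<close>

lemma nil_ideal_iff_characters_vanish:
  assumes "v \<in> carrier A"
  shows "v \<in> nil_ideal \<longleftrightarrow> (\<forall>T\<subseteq>unit_part. character T v = 0)"
proof
  assume "v \<in> nil_ideal"
  then show "\<forall>T\<subseteq>unit_part. character T v = 0"
    unfolding nil_ideal_def
  proof (induction rule: span_induct_alt)
    case base
    show ?case by simp
  next
    case (step c s v)
    then obtain V where V: "V \<subseteq> B" "V \<inter> nil_part \<noteq> {}" "s = b V" by blast
    then have "\<not> V \<subseteq> unit_part"
      by (auto simp: unit_part_def nil_part_def)
    then have "\<forall>T\<subseteq>unit_part. character T s = 0"
      using V by (auto simp: character)
    with step.IH show ?case by simp
  qed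
next
  assume zero: "\<forall>T\<subseteq>unit_part. character T v = 0"
  obtain c where c: "v = (\<Sum>V\<in>Pow B. c V *s b V)"
    using assms by (rule carrier_coeffs)
  have "(\<Sum>V\<in>Pow T. c V * (\<Prod>a\<in>V. m a)) = 0" if "T \<subseteq> unit_part" for T
    using zero that character_sum[of T c] unit_part_subset c by auto
  then have "c V * (\<Prod>a\<in>V. m a) = 0" if "V \<subseteq> unit_part" for V
    using subset_sums_zero[OF finite_parts(1), of "\<lambda>V. c V * (\<Prod>a\<in>V. m a)"] that by blast
  moreover have "(\<Prod>a\<in>V. m a) \<noteq> 0" if "V \<subseteq> unit_part" for V
    using that finite_subset[OF that finite_parts(1)] by (auto simp: unit_part_def)
  ultimately have c0: "c V = 0" if "V \<subseteq> unit_part" for V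
    using that by (metis mult_eq_0_iff)
  show "v \<in> nil_ideal"
    unfolding c nil_ideal_def
  proof (rule span_sum)
    fix V assume V: "V \<in> Pow B"
    show "c V *s b V \<in> span (b ` {V. V \<subseteq> B \<and> V \<inter> nil_part \<noteq> {}})"
    proof (cases "V \<subseteq> unit_part")
      case True
      then show ?thesis by (simp add: c0 span_zero)
    next
      case False
      then have "V \<inter> nil_part \<noteq> {}" using V by (auto simp: unit_part_def nil_part_def)
      then show ?thesis using V by (intro span_scale span_base) auto
    qed
  qed
qed

lemma characters_surjective:
  "\<exists>v\<in>carrier A. \<forall>T\<subseteq>unit_part. character T v = f T"
proof -
  obtain d where d: "\<And>T. T \<subseteq> unit_part \<Longrightarrow> (\<Sum>V\<in>Pow T. d V) = f T"
    using subset_sums_solvable[OF finite_parts(1), of f] by blast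
  \<comment> \<open>For \<open>V \<subseteq> unit_part\<close> the weight is nonzero and can be
    divided out. For all other \<open>V\<close> it is zero, and division by zero gives the
    coefficient \<open>0\<close>.\<close>
  define v where "v = (\<Sum>V\<in>Pow B. (d V / (\<Prod>a\<in>V. m a)) *s b V)"
  have "v \<in> carrier A"
    unfolding v_def carrier_A by (intro span_sum span_scale span_base) auto
  moreover have "character T v = f T" if T: "T \<subseteq> unit_part" for T
  proof -
    have "character T v = (\<Sum>V\<in>Pow T. d V / (\<Prod>a\<in>V. m a) * (\<Prod>a\<in>V. m a))"
      unfolding v_def using T unit_part_subset by (intro character_sum) auto
    also have "\<dots> = (\<Sum>V\<in>Pow T. d V)"
    proof (intro sum.cong refl)
      fix V assume "V \<in> Pow T"
      then have V: "V \<subseteq> unit_part" using T by auto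
      then have "(\<Prod>a\<in>V. m a) \<noteq> 0"
        using finite_subset[OF V finite_parts(1)] by (auto simp: unit_part_def)
      then show "d V / (\<Prod>a\<in>V. m a) * (\<Prod>a\<in>V. m a) = d V" by simp
    qed
    finally show ?thesis using d[OF T] by simp
  qed
  ultimately show ?thesis by blast
qed

text \<open>Multiplying basis elements unites their index sets, so an index set that meets
  \<open>nil_part\<close> continues to do so.\<close>

lemma ideal_nil_ideal: "ideal nil_ideal A"
proof (intro idealI ring_A)
  show "subgroup nil_ideal (add_monoid A)"
    using subspace_additive_subgroup[of nil_ideal] nil_ideal_subset
    by (simp add: nil_ideal_def subspace_span additive_subgroup.a_subgroup)
next
  let ?G = "b ` {V. V \<subseteq> B \<and> V \<inter> nil_part \<noteq> {}}"
  have basis: "b V \<otimes>\<^bsub>A\<^esub> b W \<in> span ?G"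
    if "V \<subseteq> B" "W \<subseteq> B" "(V \<union> W) \<inter> nil_part \<noteq> {}" for V W
    unfolding mult_basis[OF that(1,2)] using that by (intro span_scale[OF span_base] imageI) blast
  fix u v assume "u \<in> nil_ideal" "v \<in> carrier A"
  then have u: "u \<in> span ?G" and v: "v \<in> span (b ` Pow B)"
    by (simp_all add: nil_ideal_def carrier_A)
  show "v \<otimes>\<^bsub>A\<^esub> u \<in> nil_ideal"
    unfolding nil_ideal_def using v u by (rule mult_mem_span) (use basis in blast)
  show "u \<otimes>\<^bsub>A\<^esub> v \<in> nil_ideal"
    unfolding nil_ideal_def using u v by (rule mult_mem_span) (use basis in blast)
qed

text \<open>The isomorphism is joint evaluation at the characters of all subsets of
  \<open>unit_part\<close>. Matrices indexed by the one-point type serve as one-by-one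
  matrices.\<close>

lemma quotient_nil_ideal_isomorphic:
  "algebra_isomorphic (quotient_algebra A nil_ideal)
     (direct_sum_copies (2 ^ card unit_part) (mat_algebra (UNIV :: unit set)))"
proof -
  let ?N = "2 ^ card unit_part :: nat"
  let ?D = "direct_sum_copies ?N (mat_algebra (UNIV :: unit set)) :: ('f, nat \<Rightarrow> unit \<Rightarrow> unit \<Rightarrow> 'f) module"
  have "card (Pow unit_part) = ?N" by (simp add: card_Pow finite_parts)
  \<comment> \<open>\<open>e\<close> numbers the subsets of \<open>unit_part\<close>, because the
    summands of \<open>direct_sum_copies\<close> are indexed by numbers.\<close>
  then obtain e where e: "bij_betw e {..<?N} (Pow unit_part)"
    using ex_bij_betw_nat_finite[of "Pow unit_part"] finite_parts by (auto simp: atLeast0LessThan)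
  define h where "h v = (\<lambda>i\<in>{..<?N}. \<lambda>(_::unit) (_::unit). character (e i) v)" for v
  have D_ring: "ring ?D"
    by (intro direct_sum_copies_ring mat_algebra_ring) simp
  have "character T (b {}) = 1" for T by (simp add: character)
  then have hom: "h \<in> ring_hom A ?D"
    by (intro ring_hom_memI)
      (auto simp: h_def direct_sum_copies_def mat_algebra_simps fun_eq_iff character_mult
        one_A add_A restrict_def)
  have surj: "h ` carrier A = carrier ?D"
  proof
    show "h ` carrier A \<subseteq> carrier ?D"
      using hom by (auto simp: ring_hom_def)
    show "carrier ?D \<subseteq> h ` carrier A"
    proof
      fix w assume "w \<in> carrier ?D"
      then have w: "w \<in> extensional {..<?N}"
        by (auto simp: direct_sum_copies_def PiE_def)
      obtain v where v: "v \<in> carrier A"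
        "\<And>T. T \<subseteq> unit_part \<Longrightarrow> character T v = w (inv_into {..<?N} e T) () ()"
        using characters_surjective[of "\<lambda>T. w (inv_into {..<?N} e T) () ()"] by blast
      have "h v = w"
      proof (rule extensionalityI[OF _ w])
        show "h v \<in> extensional {..<?N}" by (simp add: h_def)
        fix i assume i: "i \<in> {..<?N}"
        then have "e i \<subseteq> unit_part" "inv_into {..<?N} e (e i) = i"
          using e by (auto simp: bij_betw_def)
        then show "h v i = w i" using v(2)[of "e i"] i by (simp add: h_def fun_eq_iff)
      qed
      then show "w \<in> h ` carrier A" using v(1) by blast
    qed
  qed
  have ker: "nil_ideal = a_kernel A ?D h"
  proof -
    have e_image: "e ` {..<?N} = Pow unit_part"
      using e by (simp add: bij_betw_def)
    have "h v = \<zero>\<^bsub>?D\<^esub> \<longleftrightarrow> v \<in> nil_ideal" if v: "v \<in> carrier A" for v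
    proof -
      have "h v = \<zero>\<^bsub>?D\<^esub> \<longleftrightarrow> (\<forall>i<?N. character (e i) v = 0)"
        by (auto simp: h_def direct_sum_copies_def mat_algebra_simps fun_eq_iff restrict_def)
      also have "\<dots> \<longleftrightarrow> (\<forall>T\<in>e ` {..<?N}. character T v = 0)"
        by auto
      finally show ?thesis
        unfolding e_image nil_ideal_iff_characters_vanish[OF v] by blast
    qed
    then show ?thesis
      using nil_ideal_subset unfolding a_kernel_def' by blast
  qed
  show ?thesis
  proof (rule quotient_algebra_isomorphic[OF ring_A D_ring hom surj ker])
    fix c v assume v: "v \<in> carrier A"
    then show "c \<odot>\<^bsub>A\<^esub> v \<in> carrier A" by (simp add: smult_A carrier_A span_scale)
    show "h (c \<odot>\<^bsub>A\<^esub> v) = c \<odot>\<^bsub>?D\<^esub> h v"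
      by (auto simp: h_def smult_A direct_sum_copies_def mat_algebra_simps mat_scale_def fun_eq_iff)
  qed
qed

section \<open>The radical and its nilpotent index\<close>

text \<open>The kernel of a character has codimension one: together with any single \<open>w\<close>
  outside it, it generates everything.\<close>

lemma maximal_left_ideal_character:
  "maximal_left_ideal {v \<in> carrier A. character T v = 0} A" (is "maximal_left_ideal ?M A")
  unfolding maximal_left_ideal_def
proof (intro conjI allI impI)
  show "left_ideal ?M A"
    unfolding left_ideal_def
  proof (intro conjI ballI)
    show "additive_subgroup ?M A"
      by (rule subspace_additive_subgroup)
        (auto simp: subspace_def carrier_A span_zero span_add span_scale)
  qed (auto simp: character_mult)
  have one: "character T (b {}) = 1" by (simp add: character)
  show "?M \<noteq> carrier A"
  proof
    assume "?M = carrier A"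
    then have "b {} \<in> ?M" using basis_in_carrier[of "{}"] by blast
    then show False using one by simp
  qed
  fix J assume J: "left_ideal J A \<and> ?M \<subseteq> J"
  then interpret J: additive_subgroup J A by (simp add: left_ideal_def)
  show "J = ?M \<or> J = carrier A"
  proof (rule disjCI)
    assume "J \<noteq> carrier A"
    have "w \<in> ?M" if w: "w \<in> J" for w
    proof (rule ccontr)
      assume "w \<notin> ?M"
      then have w': "w \<in> carrier A" "character T w \<noteq> 0" using w by auto
      have "v \<in> J" if v: "v \<in> carrier A" for v
      proof -
        \<comment> \<open>This \<open>c\<close> puts \<open>v - c *s w\<close> into the kernel. A
          left ideal is closed under ring multiplication, so the scaling of \<open>w\<close> is
          performed by the factor \<open>c *s b {}\<close>.\<close>
        define c where "c = character T v / character T w"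
        have "c *s b {} \<in> carrier A"
          using basis_in_carrier[of "{}"] by (simp add: carrier_A span_scale)
        then have "(c *s b {}) \<otimes>\<^bsub>A\<^esub> w \<in> J"
          using J w unfolding left_ideal_def by blast
        then have cw: "c *s w \<in> J"
          using w' by (simp add: mult_scale_left one_mult)
        have "character T (v - c *s w) = character T (v + (- c) *s w)" by simp
        also have "\<dots> = 0" unfolding character_linear c_def using w' by simp
        finally have "v - c *s w \<in> ?M"
          using v w'(1) unfolding carrier_A by (simp add: span_diff span_scale)
        then have "v - c *s w \<in> J" using J by blast
        then have "(v - c *s w) \<oplus>\<^bsub>A\<^esub> (c *s w) \<in> J"
          using cw by (rule J.a_closed)
        then show ?thesis by (simp add: add_A)
      qed
      with \<open>J \<noteq> carrier A\<close> show False using J.a_subset by blast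
    qed
    then show "J = ?M" using J by blast
  qed
qed

text \<open>The filtration by the number of nil coordinates rises by at least one with each factor
  from \<open>nil_ideal\<close>.\<close>

lemma nil_ideal_products:
  assumes "set vs \<subseteq> nil_ideal"
  shows "foldr (\<otimes>\<^bsub>A\<^esub>) vs \<one>\<^bsub>A\<^esub> \<in> span (b ` {V. V \<subseteq> B \<and> length vs \<le> card (V \<inter> nil_part)})"
  using assms
proof (induction vs)
  case Nil
  show ?case by (auto simp: one_A intro!: span_base)
next
  case (Cons v vs)
  have "v \<otimes>\<^bsub>A\<^esub> foldr (\<otimes>\<^bsub>A\<^esub>) vs \<one>\<^bsub>A\<^esub> \<in> span (b ` {V. V \<subseteq> B \<and> Suc (length vs) \<le> card (V \<inter> nil_part)})"
  proof (rule mult_mem_span)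
    show "v \<in> span (b ` {V. V \<subseteq> B \<and> V \<inter> nil_part \<noteq> {}})"
      using Cons.prems by (simp add: nil_ideal_def)
    show "foldr (\<otimes>\<^bsub>A\<^esub>) vs \<one>\<^bsub>A\<^esub> \<in> span (b ` {V. V \<subseteq> B \<and> length vs \<le> card (V \<inter> nil_part)})"
      using Cons by simp
    fix s t assume "s \<in> b ` {V. V \<subseteq> B \<and> V \<inter> nil_part \<noteq> {}}"
      and "t \<in> b ` {V. V \<subseteq> B \<and> length vs \<le> card (V \<inter> nil_part)}"
    then obtain V W where s: "s = b V" "V \<subseteq> B" "V \<inter> nil_part \<noteq> {}"
      and t: "t = b W" "W \<subseteq> B" "length vs \<le> card (W \<inter> nil_part)" by blast
    show "s \<otimes>\<^bsub>A\<^esub> t \<in> span (b ` {V. V \<subseteq> B \<and> Suc (length vs) \<le> card (V \<inter> nil_part)})"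
    \<comment> \<open>A repeated nil coordinate makes the structure constant zero; otherwise the
      numbers of nil coordinates add up.\<close>
    proof (cases "V \<inter> W \<inter> nil_part = {}")
      case False
      then have "\<exists>a\<in>V \<inter> W. m a = 0" by (auto simp: nil_part_def)
      moreover have "finite (V \<inter> W)" using s finite_B finite_subset by blast
      ultimately have "(\<Prod>a\<in>V \<inter> W. m a) = 0" by (simp add: prod_zero)
      then show ?thesis using s t by (simp add: mult_basis span_zero)
    next
      case True
      have "card ((V \<union> W) \<inter> nil_part) = card (V \<inter> nil_part) + card (W \<inter> nil_part)"
        unfolding Int_Un_distrib2 using True finite_parts by (intro card_Un_disjoint) auto
      moreover have "card (V \<inter> nil_part) > 0"
        using s finite_parts by (simp add: card_gt_0_iff)
      ultimately show ?thesis
        using s t by (auto simp: mult_basis intro!: span_scale[OF span_base])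
    qed
  qed
  then show ?case by simp
qed

text \<open>One factor more than there are nil coordinates leaves no admissible index set, and the
  span of the empty set is zero.\<close>

lemma products_vanish_nil_ideal: "products_vanish A nil_ideal (card nil_part + 1)"
  unfolding products_vanish_def
proof (intro allI impI)
  fix vs assume vs: "length vs = card nil_part + 1 \<and> set vs \<subseteq> nil_ideal"
  have "card (V \<inter> nil_part) \<le> card nil_part" for V
    using finite_parts by (intro card_mono) auto
  then have "{V. V \<subseteq> B \<and> length vs \<le> card (V \<inter> nil_part)} = {}"
    using vs by (auto simp: not_le less_Suc_eq_le)
  then have "foldr (\<otimes>\<^bsub>A\<^esub>) vs \<one>\<^bsub>A\<^esub> \<in> span (b ` {})"
    using nil_ideal_products[of vs] vs by metis
  then show "foldr (\<otimes>\<^bsub>A\<^esub>) vs \<one>\<^bsub>A\<^esub> = \<zero>\<^bsub>A\<^esub>"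
    by (simp add: zero_A)
qed

lemma foldr_singleton_basis:
  assumes "distinct as" "set as \<subseteq> B"
  shows "foldr (\<otimes>\<^bsub>A\<^esub>) (map (\<lambda>a. b {a}) as) \<one>\<^bsub>A\<^esub> = b (set as)"
  using assms by (induction as) (simp_all add: one_A mult_basis)

text \<open>The product of \<open>b {a}\<close> over \<open>k\<close> distinct nil coordinates has
  all structure constants equal to \<open>1\<close>, so it is a basis element and hence
  nonzero.\<close>

lemma products_not_vanish_nil_ideal:
  assumes "k \<le> card nil_part"
  shows "\<not> products_vanish A nil_ideal k"
proof -
  obtain as where as: "distinct as" "set as = nil_part"
    using finite_distinct_list finite_parts by blast
  define vs where "vs = map (\<lambda>a. b {a}) (take k as)"
  have sub: "set (take k as) \<subseteq> nil_part" using as set_take_subset by metis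
  then have sub_B: "set (take k as) \<subseteq> B" by (auto simp: nil_part_def)
  have "length vs = k"
    using as assms distinct_card[of as] by (simp add: vs_def)
  moreover have "set vs \<subseteq> nil_ideal"
    using sub sub_B by (auto simp: vs_def nil_ideal_def intro!: span_base)
  moreover have "foldr (\<otimes>\<^bsub>A\<^esub>) vs \<one>\<^bsub>A\<^esub> \<noteq> \<zero>\<^bsub>A\<^esub>"
    unfolding vs_def zero_A using as sub_B basis_nonzero
    by (subst foldr_singleton_basis) auto
  ultimately show ?thesis unfolding products_vanish_def by blast
qed

lemma nilpotent_nil_ideal: "nilpotent_ideal A nil_ideal"
  unfolding nilpotent_ideal_def
  by (intro conjI ideal_nil_ideal exI[of _ "card nil_part + 1"] products_vanish_nil_ideal) simp

lemma nilpotent_index_nil_ideal: "nilpotent_index A nil_ideal = card nil_part + 1"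
  unfolding nilpotent_index_def
proof (rule Least_equality)
  show "1 \<le> card nil_part + 1 \<and> products_vanish A nil_ideal (card nil_part + 1)"
    using products_vanish_nil_ideal by simp
  show "card nil_part + 1 \<le> k" if "1 \<le> k \<and> products_vanish A nil_ideal k" for k
    using that products_not_vanish_nil_ideal[of k] by linarith
qed

text \<open>A nilpotent ideal lies in every maximal left ideal. Conversely the kernels of the
  characters are maximal left ideals, and they already intersect in
  \<open>nil_ideal\<close>.\<close>

lemma jacobson_radical_eq_nil_ideal: "jacobson_radical A = nil_ideal"
proof
  show "nil_ideal \<subseteq> jacobson_radical A"
    using nil_ideal_subset nilpotent_ideal_subset_maximal_left_ideal[OF ring_A nilpotent_nil_ideal]
    unfolding jacobson_radical_def by blast
  show "jacobson_radical A \<subseteq> nil_ideal"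
  proof
    fix v assume v: "v \<in> jacobson_radical A"
    then have "character T v = 0" for T
      using maximal_left_ideal_character[of T] unfolding jacobson_radical_def by blast
    then show "v \<in> nil_ideal"
      using v nil_ideal_iff_characters_vanish[of v] by (auto simp: jacobson_radical_def)
  qed
qed

end

section \<open>The corner of the Terwilliger algebra\<close>

lemma sum_fun_apply2: "(\<Sum>j\<in>S. F j) y z = (\<Sum>j\<in>S. F j y z)"
  by (induction S rule: infinite_finite_induct) auto

text \<open>Two transpositions suffice: one takes \<open>y\<close> to \<open>y'\<close>, the next
  takes the image of \<open>z\<close> to \<open>z'\<close>. The matching coincidences among the
  points keep \<open>c\<close> fixed and \<open>y'\<close> undisturbed.\<close>

lemma ex_bij_betw_fixing_point:
  assumes "y \<in> S" "z \<in> S" "y' \<in> S" "z' \<in> S"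
    and yc: "y = c \<longleftrightarrow> y' = c" and zc: "z = c \<longleftrightarrow> z' = c" and yz: "y = z \<longleftrightarrow> y' = z'"
  shows "\<exists>\<tau>. bij_betw \<tau> S S \<and> \<tau> c = c \<and> \<tau> y = y' \<and> \<tau> z = z'"
proof -
  define z1 where "z1 = transpose y y' z"
  define \<tau> where "\<tau> = transpose z1 z' \<circ> transpose y y'"
  have z1_S: "z1 \<in> S" using assms by (auto simp: z1_def transpose_def)
  have z1_c: "z1 = c \<longleftrightarrow> z' = c"
    unfolding z1_def using yc zc by (metis transpose_apply_first transpose_apply_second transpose_apply_other)
  have z1_y': "z1 = y' \<longleftrightarrow> z' = y'"
    unfolding z1_def using yz by (metis transpose_apply_first transpose_apply_second transpose_apply_other)
  have "bij_betw \<tau> S S"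
    unfolding \<tau>_def using assms z1_S by (intro bij_betw_trans[of _ _ S] bij_betw_transpose_iff) simp_all
  moreover have "\<tau> c = c"
    unfolding \<tau>_def comp_apply using yc z1_c by (metis transpose_apply_first transpose_apply_second transpose_apply_other)
  moreover have "\<tau> y = y'"
    unfolding \<tau>_def comp_apply using z1_y' by (metis transpose_apply_first transpose_apply_second transpose_apply_other)
  moreover have "\<tau> z = z'"
    by (simp add: \<tau>_def z1_def)
  ultimately show ?thesis by blast
qed

lemma supp_indicator:
  "V \<subseteq> {1..n} \<Longrightarrow> (\<lambda>a\<in>{1..n}. if a \<in> V then 1 else 0) \<in> E_set n"
  "V \<subseteq> {1..n} \<Longrightarrow> supp n (\<lambda>a\<in>{1..n}. if a \<in> V then 1 else 0) = V"
  by (auto simp: E_set_def supp_def)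

lemma supp_inject:
  assumes "i \<in> E_set n" "j \<in> E_set n"
  shows "supp n i = supp n j \<longleftrightarrow> i = j"
proof
  assume eq: "supp n i = supp n j"
  show "i = j"
  proof (rule PiE_ext)
    show "i \<in> {1..n} \<rightarrow>\<^sub>E {0, 1}" "j \<in> {1..n} \<rightarrow>\<^sub>E {0, 1}"
      using assms by (simp_all add: E_set_def)
    fix a assume a: "a \<in> {1..n}"
    then have "i a \<in> {0, 1}" "j a \<in> {0, 1}"
      using assms by (auto simp: E_set_def)
    moreover have "i a = 1 \<longleftrightarrow> j a = 1" using eq a by (auto simp: supp_def)
    ultimately show "i a = j a" by auto
  qed
qed simp

locale hamming_corner =
  fixes n :: nat and U :: "nat \<Rightarrow> 'u set" and x :: "nat \<Rightarrow> 'u" and g :: "nat \<Rightarrow> nat"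
  assumes finite_U: "\<And>h. h \<in> {1..n} \<Longrightarrow> finite (U h)"
    and card_U: "\<And>h. h \<in> {1..n} \<Longrightarrow> card (U h) \<ge> 2"
    and x_point: "x \<in> points n U"
    and g_E: "g \<in> E_set n"
begin

abbreviation "X \<equiv> points n U"

definition sphere :: "(nat \<Rightarrow> 'u) set" where
  "sphere = {y \<in> X. (x, y) \<in> R_rel n U g}"

definition differ :: "(nat \<Rightarrow> 'u) \<Rightarrow> (nat \<Rightarrow> 'u) \<Rightarrow> nat set" where
  "differ y z = {a \<in> {1..n}. y a \<noteq> z a}"

definition big :: "nat set" where
  "big = big_part U (supp n g)"

text \<open>The entrywise form of \<open>B_mat n U x g h g\<close> with
  \<open>V = supp n h\<close>.\<close>

definition basis_mat :: "nat set \<Rightarrow> (nat \<Rightarrow> 'u, 'f::field) matrix" where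
  "basis_mat V = (\<lambda>y z. if y \<in> sphere \<and> z \<in> sphere \<and> differ y z \<subseteq> V then 1 else 0)"

section \<open>Points of the sphere and their difference sets\<close>

lemma finite_X: "finite X"
  unfolding points_def by (intro finite_PiE finite_U) auto

lemma finite_E: "finite (E_set n)"
  unfolding E_set_def by (intro finite_PiE) auto

lemma sphere_subset: "sphere \<subseteq> X"
  by (auto simp: sphere_def)

lemma in_U: "y \<in> X \<Longrightarrow> a \<in> {1..n} \<Longrightarrow> y a \<in> U a"
  by (auto simp: points_def)

lemma point_eqI: "y \<in> X \<Longrightarrow> z \<in> X \<Longrightarrow> (\<And>a. a \<in> {1..n} \<Longrightarrow> y a = z a) \<Longrightarrow> y = z"
  unfolding points_def by (rule PiE_ext)

lemma sphere_iff: "y \<in> sphere \<longleftrightarrow> y \<in> X \<and> (\<forall>a\<in>{1..n}. x a \<noteq> y a \<longleftrightarrow> a \<in> supp n g)"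
  using x_point by (auto simp: sphere_def R_rel_def supp_def)

lemma R_rel_iff:
  assumes "y \<in> X" "z \<in> X"
  shows "(y, z) \<in> R_rel n U j \<longleftrightarrow> differ y z = supp n j"
proof -
  have "(y, z) \<in> R_rel n U j \<longleftrightarrow> (\<forall>a\<in>{1..n}. y a \<noteq> z a \<longleftrightarrow> j a = 1)"
    using assms by (simp add: R_rel_def)
  also have "\<dots> \<longleftrightarrow> differ y z = supp n j"
    unfolding supp_def differ_def by blast
  finally show ?thesis .
qed

lemma differ_empty_iff: "y \<in> X \<Longrightarrow> z \<in> X \<Longrightarrow> differ y z = {} \<longleftrightarrow> y = z"
  using point_eqI by (auto simp: differ_def)

lemma finite_big: "finite big"
  by (simp add: big_def big_part_def supp_def)

lemma big_subset: "big \<subseteq> {1..n}"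
  by (auto simp: big_def big_part_def supp_def)

text \<open>Where two points of the sphere differ, both also differ from \<open>x\<close>, so the
  factor has at least three elements.\<close>

lemma differ_subset_big:
  assumes "y \<in> sphere" "z \<in> sphere"
  shows "differ y z \<subseteq> big"
proof
  fix a assume "a \<in> differ y z"
  then have a: "a \<in> {1..n}" "y a \<noteq> z a" by (auto simp: differ_def)
  have supp_a: "a \<in> supp n g"
    using assms a by (metis sphere_iff)
  then have "x a \<noteq> y a" "x a \<noteq> z a"
    using assms a by (auto simp: sphere_iff)
  moreover have "{x a, y a, z a} \<subseteq> U a"
    using assms a x_point by (auto simp: sphere_iff in_U)
  then have "card {x a, y a, z a} \<le> card (U a)"
    using finite_U a by (intro card_mono) auto
  ultimately have "card (U a) > 2" using a by simp
  then show "a \<in> big" using supp_a by (simp add: big_def big_part_def)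
qed

text \<open>Each factor has a value \<open>u a\<close> other than \<open>x a\<close>, and on
  \<open>big\<close> there is room for a third value \<open>v a\<close>. The point \<open>z\<close>
  is \<open>y\<close> with \<open>u\<close> replaced by \<open>v\<close> on
  \<open>W\<close>.\<close>

lemma ex_differ_eq:
  assumes "W \<subseteq> big"
  shows "\<exists>y\<in>sphere. \<exists>z\<in>sphere. differ y z = W"
proof -
  have "\<exists>u\<in>U a. u \<noteq> x a" if a: "a \<in> {1..n}" for a
  proof (rule ccontr)
    assume "\<not> ?thesis"
    then have "card (U a) \<le> card {x a}" by (intro card_mono) auto
    then show False using card_U[OF a] by simp
  qed
  then obtain u where u: "\<forall>a\<in>{1..n}. u a \<in> U a \<and> u a \<noteq> x a" by metis
  have "\<exists>v\<in>U a. v \<noteq> x a \<and> v \<noteq> u a" if a: "a \<in> big" for a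
  proof (rule ccontr)
    assume "\<not> ?thesis"
    then have "card (U a) \<le> card {x a, u a}" by (intro card_mono) auto
    moreover have "card {x a, u a} \<le> 2" by (simp add: card_insert_if)
    ultimately show False using a by (simp add: big_def big_part_def)
  qed
  then obtain v where v: "\<forall>a\<in>big. v a \<in> U a \<and> v a \<noteq> x a \<and> v a \<noteq> u a" by metis
  define y where "y = (\<lambda>a\<in>{1..n}. if a \<in> supp n g then u a else x a)"
  define z where "z = (\<lambda>a\<in>{1..n}. if a \<in> W then v a else y a)"
  have W: "a \<in> supp n g" "a \<in> big" if "a \<in> W" for a
    using that assms by (auto simp: big_def big_part_def)
  have "y \<in> X"
    using u x_point by (auto simp: y_def points_def)
  then have "z \<in> X"
    using v W by (auto simp: z_def points_def)
  have y_a: "x a \<noteq> y a \<longleftrightarrow> a \<in> supp n g" if "a \<in> {1..n}" for a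
  proof -
    have "x a \<noteq> u a" using u that by metis
    then show ?thesis using that by (simp add: y_def)
  qed
  then have "y \<in> sphere"
    using \<open>y \<in> X\<close> by (simp add: sphere_iff)
  moreover have "x a \<noteq> z a \<longleftrightarrow> a \<in> supp n g" if a: "a \<in> {1..n}" for a
  proof (cases "a \<in> W")
    case True
    then have "x a \<noteq> v a" "a \<in> supp n g" using v W by metis+
    then show ?thesis using a True by (simp add: z_def)
  next
    case False
    then show ?thesis using y_a[OF a] a by (simp add: z_def)
  qed
  then have "z \<in> sphere"
    using \<open>z \<in> X\<close> by (simp add: sphere_iff)
  moreover have "y a \<noteq> z a \<longleftrightarrow> a \<in> W" if a: "a \<in> {1..n}" for a
  proof (cases "a \<in> W")
    case True
    then have "u a \<noteq> v a" "a \<in> supp n g" using v W by metis+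
    then show ?thesis using a True by (simp add: z_def y_def)
  next
    case False
    then show ?thesis using a by (simp add: z_def)
  qed
  then have "differ y z = W"
    unfolding differ_def using assms big_subset by blast
  ultimately show ?thesis by blast
qed

lemma triple_prod_Estar:
  "triple_prod n U (Estar n U x g) M (Estar n U x g) =
     (\<lambda>y z. if y \<in> sphere \<and> z \<in> sphere then M y z else 0)"
proof (intro ext)
  fix y z
  have left: "(\<Sum>w\<in>X. Estar n U x g y w * M w z) = (if y \<in> sphere then M y z else 0)" for z
  proof -
    have "(\<Sum>w\<in>X. Estar n U x g y w * M w z) = (\<Sum>w\<in>X. if w = y then (if y \<in> sphere then M y z else 0) else 0)"
      by (intro sum.cong) (auto simp: Estar_def sphere_def)
    then show ?thesis using finite_X by (auto simp: sphere_def)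
  qed
  have "triple_prod n U (Estar n U x g) M (Estar n U x g) y z =
      (\<Sum>w\<in>X. (if y \<in> sphere then M y w else 0) * Estar n U x g w z)"
    by (simp add: triple_prod_def mat_algebra_simps left)
  also have "\<dots> = (\<Sum>w\<in>X. if w = z then (if y \<in> sphere \<and> z \<in> sphere then M y z else 0) else 0)"
    by (intro sum.cong) (auto simp: Estar_def sphere_def)
  also have "\<dots> = (if y \<in> sphere \<and> z \<in> sphere then M y z else 0)"
    using finite_X by (auto simp: sphere_def)
  finally show "triple_prod n U (Estar n U x g) M (Estar n U x g) y z =
    (if y \<in> sphere \<and> z \<in> sphere then M y z else 0)" .
qed

section \<open>The stabiliser of \<open>x\<close> and its invariant matrices\<close>

definition stabiliser :: "(nat \<Rightarrow> 'u \<Rightarrow> 'u) set" where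
  "stabiliser = {\<sigma>. \<forall>a\<in>{1..n}. bij_betw (\<sigma> a) (U a) (U a) \<and> \<sigma> a (x a) = x a}"

definition act :: "(nat \<Rightarrow> 'u \<Rightarrow> 'u) \<Rightarrow> (nat \<Rightarrow> 'u) \<Rightarrow> (nat \<Rightarrow> 'u)" where
  "act \<sigma> y = (\<lambda>a\<in>{1..n}. \<sigma> a (y a))"

text \<open>The matrices constant on orbits of pairs, that is, commuting with the permutation
  matrices of the group. They bound \<open>T_alg\<close> from above.\<close>

definition invariants :: "(nat \<Rightarrow> 'u, 'f::field) matrix set" where
  "invariants = {M \<in> carrier (mat_algebra X).
     \<forall>\<sigma>\<in>stabiliser. \<forall>y\<in>X. \<forall>z\<in>X. M (act \<sigma> y) (act \<sigma> z) = M y z}"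

lemma act_inj:
  assumes "\<sigma> \<in> stabiliser" "y \<in> X" "z \<in> X" "a \<in> {1..n}"
  shows "act \<sigma> y a = act \<sigma> z a \<longleftrightarrow> y a = z a"
proof -
  have "inj_on (\<sigma> a) (U a)"
    using assms by (auto simp: stabiliser_def bij_betw_def)
  then show ?thesis
    using assms in_U by (auto simp: act_def inj_on_eq_iff)
qed

lemma act_closed: "\<sigma> \<in> stabiliser \<Longrightarrow> y \<in> X \<Longrightarrow> act \<sigma> y \<in> X"
  unfolding points_def act_def stabiliser_def
  by (auto dest!: bij_betw_imp_surj_on)

lemma act_fixes: "\<sigma> \<in> stabiliser \<Longrightarrow> act \<sigma> x = x"
  by (rule point_eqI) (simp_all add: act_closed x_point, simp add: act_def stabiliser_def)

lemma act_bij: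
  assumes "\<sigma> \<in> stabiliser"
  shows "bij_betw (act \<sigma>) X X"
proof -
  have "inj_on (act \<sigma>) X"
    by (intro inj_onI point_eqI) (use assms act_inj in metis)+
  moreover have "act \<sigma> ` X \<subseteq> X" using assms act_closed by blast
  ultimately show ?thesis
    using endo_inj_surj[OF finite_X] by (auto simp: bij_betw_def)
qed

lemma act_eq_iff:
  "\<sigma> \<in> stabiliser \<Longrightarrow> y \<in> X \<Longrightarrow> z \<in> X \<Longrightarrow> act \<sigma> y = act \<sigma> z \<longleftrightarrow> y = z"
  using act_bij by (meson bij_betw_def inj_on_eq_iff)

lemma differ_act:
  "\<sigma> \<in> stabiliser \<Longrightarrow> y \<in> X \<Longrightarrow> z \<in> X \<Longrightarrow> differ (act \<sigma> y) (act \<sigma> z) = differ y z"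
  using act_inj by (auto simp: differ_def)

text \<open>In each coordinate the coincidences among \<open>x\<close>, \<open>y\<close> and
  \<open>z\<close> equal those among \<open>x\<close>, \<open>y'\<close> and \<open>z'\<close>, so
  the permutation can be chosen coordinate by coordinate.\<close>

lemma act_transitive:
  assumes "y \<in> sphere" "z \<in> sphere" "y' \<in> sphere" "z' \<in> sphere" "differ y z = differ y' z'"
  shows "\<exists>\<sigma>\<in>stabiliser. act \<sigma> y = y' \<and> act \<sigma> z = z'"
proof -
  have X: "y \<in> X" "z \<in> X" "y' \<in> X" "z' \<in> X" using assms by (auto simp: sphere_iff)
  have "\<exists>\<tau>. bij_betw \<tau> (U a) (U a) \<and> \<tau> (x a) = x a \<and> \<tau> (y a) = y' a \<and> \<tau> (z a) = z' a"
    if a: "a \<in> {1..n}" for a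
  proof (rule ex_bij_betw_fixing_point)
    show "y a = x a \<longleftrightarrow> y' a = x a" "z a = x a \<longleftrightarrow> z' a = x a"
      using assms a by (metis sphere_iff)+
    show "y a = z a \<longleftrightarrow> y' a = z' a"
      using assms(5) a by (auto simp: differ_def)
  qed (use X a in_U in auto)
  then obtain \<sigma> where \<sigma>: "\<And>a. a \<in> {1..n} \<Longrightarrow> bij_betw (\<sigma> a) (U a) (U a) \<and> \<sigma> a (x a) = x a \<and>
      \<sigma> a (y a) = y' a \<and> \<sigma> a (z a) = z' a" by metis
  then have stab: "\<sigma> \<in> stabiliser" by (simp add: stabiliser_def)
  have "act \<sigma> y = y'" "act \<sigma> z = z'"
    by (rule point_eqI; simp add: act_closed stab X; simp add: act_def \<sigma>)+
  with stab show ?thesis by blast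
qed

lemma invariants_subalgebra: "is_subalgebra (mat_algebra X) invariants"
  unfolding is_subalgebra_def
proof (intro conjI allI ballI)
  interpret ring "mat_algebra X :: ('f::field, (nat \<Rightarrow> 'u, 'f) matrix) module"
    by (rule mat_algebra_ring[OF finite_X])
  have minus: "\<ominus>\<^bsub>mat_algebra X\<^esub> M = - M" if "M \<in> carrier (mat_algebra X)"
    for M :: "(nat \<Rightarrow> 'u, 'f) matrix"
    using that by (intro minus_equality) (auto simp: mat_algebra_simps)
  show "subring invariants (mat_algebra X :: ('f, (nat \<Rightarrow> 'u, 'f) matrix) module)"
  proof (rule subringI)
    show "invariants \<subseteq> carrier (mat_algebra X :: ('f, (nat \<Rightarrow> 'u, 'f) matrix) module)"
      by (auto simp: invariants_def)
    show "\<one>\<^bsub>mat_algebra X\<^esub> \<in> (invariants :: (nat \<Rightarrow> 'u, 'f) matrix set)"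
      by (auto simp: invariants_def mat_algebra_simps act_closed act_eq_iff)
  next
    fix M N :: "(nat \<Rightarrow> 'u, 'f) matrix"
    assume M: "M \<in> invariants"
    then show "\<ominus>\<^bsub>mat_algebra X\<^esub> M \<in> invariants"
      by (subst minus) (auto simp: invariants_def mat_algebra_simps)
    assume N: "N \<in> invariants"
    show "M \<oplus>\<^bsub>mat_algebra X\<^esub> N \<in> invariants"
      using M N by (auto simp: invariants_def mat_algebra_simps)
    have "(\<Sum>w\<in>X. M (act \<sigma> y) w * N w (act \<sigma> z)) = (\<Sum>w\<in>X. M y w * N w z)"
      if "\<sigma> \<in> stabiliser" "y \<in> X" "z \<in> X" for \<sigma> y z
    proof -
      \<comment> \<open>The summation index \<open>w\<close> is replaced by
        \<open>act \<sigma> w\<close>, which permutes \<open>X\<close>.\<close>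
      have "(\<Sum>w\<in>X. M (act \<sigma> y) w * N w (act \<sigma> z)) =
          (\<Sum>w\<in>X. M (act \<sigma> y) (act \<sigma> w) * N (act \<sigma> w) (act \<sigma> z))"
        by (rule sum.reindex_bij_betw[OF act_bij[OF that(1)], symmetric])
      also have "\<dots> = (\<Sum>w\<in>X. M y w * N w z)"
        using M N that by (intro sum.cong) (auto simp: invariants_def)
      finally show ?thesis .
    qed
    moreover have "M \<otimes>\<^bsub>mat_algebra X\<^esub> N \<in> carrier (mat_algebra X)"
      using M N by (intro m_closed) (auto simp: invariants_def)
    ultimately show "M \<otimes>\<^bsub>mat_algebra X\<^esub> N \<in> invariants"
      by (simp add: invariants_def mat_algebra_simps(2))
  qed
qed (auto simp: invariants_def mat_algebra_simps mat_scale_def)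

text \<open>The relations depend only on difference sets, which the action preserves; for the dual
  idempotents the action moreover fixes \<open>x\<close>.\<close>

lemma T_alg_subset_invariants: "T_alg n U x \<subseteq> invariants"
  unfolding T_alg_def generated_subalgebra_def
proof (rule hull_minimal)
  show "is_subalgebra (mat_algebra X) invariants" by (rule invariants_subalgebra)
  show "A_mat n U ` E_set n \<union> Estar n U x ` E_set n \<subseteq> invariants"
  proof (intro Un_least image_subsetI)
    fix j assume "j \<in> E_set n"
    show "A_mat n U j \<in> invariants"
      by (auto simp: invariants_def mat_algebra_simps A_mat_def R_rel_iff act_closed differ_act)
        (auto simp: R_rel_def)
    have "(x, act \<sigma> y) \<in> R_rel n U j \<longleftrightarrow> (x, y) \<in> R_rel n U j"
      if "\<sigma> \<in> stabiliser" "y \<in> X" for \<sigma> y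
      using that differ_act[of \<sigma> x y] act_fixes[of \<sigma>] x_point by (simp add: R_rel_iff act_closed)
    then show "Estar n U x j \<in> invariants"
      by (auto simp: invariants_def mat_algebra_simps Estar_def act_eq_iff) (auto simp: R_rel_def)
  qed
qed

text \<open>The lower bound for \<open>T_alg\<close>: these combinations already realise every
  function of the difference set.\<close>

lemma sum_A_mat_in_T_alg:
  "(\<Sum>j\<in>E_set n. mat_scale (c j) (A_mat n U j)) \<in> T_alg n U x"
  unfolding T_alg_def generated_subalgebra_def hull_def
proof (intro InterI, elim CollectE conjE)
  fix K :: "(nat \<Rightarrow> 'u, 'a) matrix set"
  assume "is_subalgebra (mat_algebra X) K" and gen: "A_mat n U ` E_set n \<union> Estar n U x ` E_set n \<subseteq> K"
  then have K: "subring K (mat_algebra X)" "\<And>c M. M \<in> K \<Longrightarrow> mat_scale c M \<in> K"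
    by (auto simp: is_subalgebra_def mat_algebra_simps)
  have zero: "0 \<in> K" and add: "\<And>M N. M \<in> K \<Longrightarrow> N \<in> K \<Longrightarrow> M + N \<in> K"
    using subringE(2)[OF K(1)] subringE(7)[OF K(1)] by (auto simp: mat_algebra_simps)
  have "(\<Sum>j\<in>S. mat_scale (c j) (A_mat n U j)) \<in> K" if "S \<subseteq> E_set n" for S
    using finite_subset[OF that finite_E] that
    by (induction S rule: finite_induct) (use zero add K(2) gen in auto)
  then show "(\<Sum>j\<in>E_set n. mat_scale (c j) (A_mat n U j)) \<in> K" by simp
qed

section \<open>The corner as the functions of the difference set\<close>

text \<open>Exactly one \<open>j\<close> has \<open>differ y z\<close> as support. The filter
  \<open>P\<close> covers both \<open>B_mat\<close> and the unrestricted sum.\<close>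

lemma sum_E_set_delta:
  fixes f :: "nat set \<Rightarrow> 'f::field"
  assumes "y \<in> X" "z \<in> X"
  shows "(\<Sum>j\<in>{j \<in> E_set n. P (supp n j)}. f (supp n j) * A_mat n U j y z) =
    (if P (differ y z) then f (differ y z) else 0)"
proof -
  define i :: "nat \<Rightarrow> nat" where "i = (\<lambda>a\<in>{1..n}. if a \<in> differ y z then 1 else 0)"
  have sub: "differ y z \<subseteq> {1..n}" by (auto simp: differ_def)
  note i = supp_indicator[OF sub, folded i_def]
  have "(\<Sum>j\<in>{j \<in> E_set n. P (supp n j)}. f (supp n j) * A_mat n U j y z) =
      (\<Sum>j\<in>{j \<in> E_set n. P (supp n j)}. if j = i then f (differ y z) else 0)"
  proof (intro sum.cong refl)
    fix j assume j: "j \<in> {j \<in> E_set n. P (supp n j)}"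
    then have "j = i \<longleftrightarrow> differ y z = supp n j"
      using supp_inject[of i n j] i by auto
    then show "f (supp n j) * A_mat n U j y z = (if j = i then f (differ y z) else 0)"
      using assms by (auto simp: A_mat_def R_rel_iff)
  qed
  also have "\<dots> = (if P (differ y z) then f (differ y z) else 0)"
    using finite_E i by simp
  finally show ?thesis .
qed

lemma B_mat_eq_basis_mat: "B_mat n U x g h g = basis_mat (supp n h)"
proof (intro ext)
  fix y z
  let ?J = "{j \<in> E_set n. supp n j \<subseteq> supp n h}"
  have "B_mat n U x g h g y z = (\<Sum>j\<in>?J. if y \<in> sphere \<and> z \<in> sphere then A_mat n U j y z else 0)"
    by (simp add: B_mat_def triple_prod_Estar sum_fun_apply2)
  also have "\<dots> = (basis_mat (supp n h) y z :: 'a)"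
  proof (cases "y \<in> sphere \<and> z \<in> sphere")
    case True
    then have "(\<Sum>j\<in>?J. 1 * A_mat n U j y z) = (if differ y z \<subseteq> supp n h then 1 else (0::'a))"
      using sphere_subset by (intro sum_E_set_delta[where f = "\<lambda>_. 1"]) auto
    with True show ?thesis by (simp add: basis_mat_def)
  qed (auto simp: basis_mat_def)
  finally show "B_mat n U x g h g y z = (basis_mat (supp n h) y z :: 'a)" .
qed

definition sphere_mat :: "(nat set \<Rightarrow> 'f) \<Rightarrow> (nat \<Rightarrow> 'u, 'f::field) matrix" where
  "sphere_mat f = (\<lambda>y z. if y \<in> sphere \<and> z \<in> sphere then f (differ y z) else 0)"

lemma carrier_corner_eq_sphere_mat: "carrier (corner_algebra n U x g) = range sphere_mat"
proof -
  let ?p = "\<lambda>M :: (nat \<Rightarrow> 'u, 'a) matrix. triple_prod n U (Estar n U x g) M (Estar n U x g)"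
  have "?p ` T_alg n U x = range sphere_mat"
  proof
    show "?p ` T_alg n U x \<subseteq> range sphere_mat"
    proof (rule image_subsetI)
      fix M :: "(nat \<Rightarrow> 'u, 'a) matrix" assume "M \<in> T_alg n U x"
      then have M: "M \<in> invariants" using T_alg_subset_invariants by blast
      \<comment> \<open>\<open>f W\<close> is the entry of \<open>M\<close> at some pair with
        difference set \<open>W\<close>. Transitivity and invariance make the choice of the pair
        immaterial.\<close>
      define f where "f W = (SOME c. \<exists>y\<in>sphere. \<exists>z\<in>sphere. differ y z = W \<and> c = M y z)" for W
      have "f (differ y z) = M y z" if yz: "y \<in> sphere" "z \<in> sphere" for y z
      proof -
        have "\<exists>y'\<in>sphere. \<exists>z'\<in>sphere. differ y' z' = differ y z \<and> f (differ y z) = M y' z'"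
          unfolding f_def by (rule someI[of _ "M y z"]) (use yz in blast)
        then obtain y' z' where y'z': "y' \<in> sphere" "z' \<in> sphere" "differ y z = differ y' z'"
          "f (differ y z) = M y' z'" by metis
        obtain \<sigma> where "\<sigma> \<in> stabiliser" "act \<sigma> y = y'" "act \<sigma> z = z'"
          using act_transitive[OF yz y'z'(1-3)] by blast
        then have "M y' z' = M y z"
          using M yz sphere_subset unfolding invariants_def by blast
        then show ?thesis using y'z' by simp
      qed
      then have "?p M = sphere_mat f"
        by (auto simp: triple_prod_Estar sphere_mat_def fun_eq_iff)
      then show "?p M \<in> range sphere_mat" by blast
    qed
    show "range sphere_mat \<subseteq> ?p ` T_alg n U x"
    proof (rule image_subsetI)
      fix f :: "nat set \<Rightarrow> 'a"
      let ?N = "\<Sum>j\<in>E_set n. mat_scale (f (supp n j)) (A_mat n U j)"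
      have "?N y z = f (differ y z)" if "y \<in> sphere" "z \<in> sphere" for y z
        using sum_E_set_delta[OF subsetD[OF sphere_subset that(1)] subsetD[OF sphere_subset that(2)],
          where P = "\<lambda>_. True" and f = f] by (simp add: sum_fun_apply2 mat_scale_def)
      then have "sphere_mat f = ?p ?N"
        by (simp add: triple_prod_Estar sphere_mat_def fun_eq_iff)
      then show "sphere_mat f \<in> ?p ` T_alg n U x"
        using sum_A_mat_in_T_alg by (rule image_eqI)
    qed
  qed
  then show ?thesis by (simp add: corner_algebra_def)
qed

section \<open>A basis of the corner and its structure constants\<close>

text \<open>At a pair with difference set \<open>W\<close> exactly the \<open>basis_mat V\<close>
  with \<open>W \<subseteq> V\<close> contribute, which produces sums over supersets.\<close>

lemma sum_basis_mat:
  "(\<Sum>V\<in>Pow big. mat_scale (c V) (basis_mat V)) =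
    sphere_mat (\<lambda>W. \<Sum>V\<in>{V. W \<subseteq> V \<and> V \<subseteq> big}. c V)"
proof (intro ext)
  fix y z
  have "(\<Sum>V\<in>Pow big. c V * (if differ y z \<subseteq> V then 1 else 0)) =
      (\<Sum>V\<in>{V. differ y z \<subseteq> V \<and> V \<subseteq> big}. c V)"
    using finite_big by (intro sum.mono_neutral_cong_right) auto
  then show "(\<Sum>V\<in>Pow big. mat_scale (c V) (basis_mat V)) y z =
      sphere_mat (\<lambda>W. \<Sum>V\<in>{V. W \<subseteq> V \<and> V \<subseteq> big}. c V) y z"
    by (auto simp: sum_fun_apply2 mat_scale_def basis_mat_def sphere_mat_def)
qed

lemma range_sphere_mat:
  "range sphere_mat = module.span mat_scale (basis_mat ` Pow big)"
proof -
  interpret vector_space "mat_scale :: 'f \<Rightarrow> (nat \<Rightarrow> 'u, 'f::field) matrix \<Rightarrow> (nat \<Rightarrow> 'u, 'f) matrix"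
    by (rule vector_space_mat_scale)
  show "range (sphere_mat :: (nat set \<Rightarrow> 'f) \<Rightarrow> _) = span (basis_mat ` Pow big)"
  proof
    show "range (sphere_mat :: (nat set \<Rightarrow> 'f) \<Rightarrow> _) \<subseteq> span (basis_mat ` Pow big)"
    proof (rule image_subsetI)
      fix f :: "nat set \<Rightarrow> 'f"
      \<comment> \<open>Prescribing the superset sums for \<open>W \<subseteq> big\<close> is
        enough, since no other difference sets occur on the sphere.\<close>
      obtain d where d: "\<And>W. W \<subseteq> big \<Longrightarrow> (\<Sum>V\<in>{V. W \<subseteq> V \<and> V \<subseteq> big}. d V) = f W"
        using superset_sums_solvable[OF finite_big, of f] by blast
      have "sphere_mat f = sphere_mat (\<lambda>W. \<Sum>V\<in>{V. W \<subseteq> V \<and> V \<subseteq> big}. d V)"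
        using d differ_subset_big by (auto simp: sphere_mat_def fun_eq_iff)
      also have "\<dots> = (\<Sum>V\<in>Pow big. mat_scale (d V) (basis_mat V))"
        by (simp add: sum_basis_mat)
      also have "\<dots> \<in> span (basis_mat ` Pow big)"
        by (intro span_sum span_scale span_base) auto
      finally show "sphere_mat f \<in> span (basis_mat ` Pow big)" .
    qed
    show "span (basis_mat ` Pow big) \<subseteq> range (sphere_mat :: (nat set \<Rightarrow> 'f) \<Rightarrow> _)"
    proof (rule span_minimal)
      have "basis_mat V = sphere_mat (\<lambda>W. if W \<subseteq> V then 1 else (0::'f))" for V
        by (auto simp: basis_mat_def sphere_mat_def fun_eq_iff)
      then show "basis_mat ` Pow big \<subseteq> range (sphere_mat :: (nat set \<Rightarrow> 'f) \<Rightarrow> _)" by blast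
      show "subspace (range (sphere_mat :: (nat set \<Rightarrow> 'f) \<Rightarrow> _))"
      proof (rule subspaceI)
        have "0 = sphere_mat (\<lambda>_. 0 :: 'f)" by (auto simp: sphere_mat_def fun_eq_iff)
        then show "0 \<in> range (sphere_mat :: (nat set \<Rightarrow> 'f) \<Rightarrow> _)" by blast
      next
        fix M N assume "M \<in> range (sphere_mat :: (nat set \<Rightarrow> 'f) \<Rightarrow> _)" "N \<in> range (sphere_mat :: (nat set \<Rightarrow> 'f) \<Rightarrow> _)"
        then obtain f1 f2 where "M = sphere_mat f1" "N = sphere_mat f2" by blast
        then have "M + N = sphere_mat (\<lambda>W. f1 W + f2 W)"
          by (auto simp: sphere_mat_def fun_eq_iff)
        then show "M + N \<in> range (sphere_mat :: (nat set \<Rightarrow> 'f) \<Rightarrow> _)" by blast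
      next
        fix c M assume "M \<in> range (sphere_mat :: (nat set \<Rightarrow> 'f) \<Rightarrow> _)"
        then obtain f where "M = sphere_mat f" by blast
        then have "mat_scale c M = sphere_mat (\<lambda>W. c * f W)"
          by (auto simp: sphere_mat_def mat_scale_def fun_eq_iff)
        then show "mat_scale c M \<in> range (sphere_mat :: (nat set \<Rightarrow> 'f) \<Rightarrow> _)" by blast
      qed
    qed
  qed
qed

text \<open>The entry at \<open>(y, z)\<close> counts the intermediate points \<open>w\<close> of
  the sphere. The count factors over coordinates: \<open>card (U a) - 1\<close> choices on
  \<open>V \<inter> W\<close> and one elsewhere, provided that
  \<open>differ y z \<subseteq> V \<union> W\<close>.\<close>

lemma basis_mat_mult:
  assumes "V \<subseteq> big" "W \<subseteq> big"
  shows "basis_mat V \<otimes>\<^bsub>mat_algebra X\<^esub> basis_mat W =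
    mat_scale (\<Prod>a\<in>V \<inter> W. of_nat (card (U a) - 1)) (basis_mat (V \<union> W) :: (nat \<Rightarrow> 'u, 'f::field) matrix)"
proof (intro ext)
  fix y z
  let ?Q = "{w \<in> sphere. differ y w \<subseteq> V \<and> differ w z \<subseteq> W}"
  show "(basis_mat V \<otimes>\<^bsub>mat_algebra X\<^esub> basis_mat W) y z =
    mat_scale (\<Prod>a\<in>V \<inter> W. of_nat (card (U a) - 1)) (basis_mat (V \<union> W) :: (nat \<Rightarrow> 'u, 'f) matrix) y z"
  proof (cases "y \<in> sphere \<and> z \<in> sphere")
    case True
    then have yz: "y \<in> sphere" "z \<in> sphere" "y \<in> X" "z \<in> X" using sphere_subset by auto
    have "(basis_mat V \<otimes>\<^bsub>mat_algebra X\<^esub> basis_mat W) y z = (\<Sum>w\<in>X. if w \<in> ?Q then 1 else (0::'f))"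
      using yz by (auto simp: mat_algebra_simps basis_mat_def intro!: sum.cong)
    also have "\<dots> = of_nat (card ?Q)"
      using finite_X sphere_subset by (subst sum.inter_restrict[symmetric]) (auto simp: Int_absorb1 subset_iff)
    also have "card ?Q = (if differ y z \<subseteq> V \<union> W then (\<Prod>a\<in>V \<inter> W. card (U a) - 1) else 0)"
    proof (cases "differ y z \<subseteq> V \<union> W")
      case False
      have "differ y z \<subseteq> differ y w \<union> differ w z" for w by (auto simp: differ_def)
      then have "?Q = {}" using False by blast
      then show ?thesis using False by (simp only: if_False card.empty)
    next
      case sub: True
      \<comment> \<open>\<open>w\<close> must agree with \<open>y\<close> outside \<open>V\<close>
        and with \<open>z\<close> outside \<open>W\<close>, and on \<open>V \<inter> W\<close> it
        must avoid \<open>x\<close>. Outside both sets \<open>y\<close> and \<open>z\<close>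
        coincide, so \<open>y a\<close> satisfies both demands.\<close>
      define F where "F a = (if a \<in> V \<inter> W then U a - {x a} else if a \<in> V then {z a} else {y a})" for a
      have VW: "V \<subseteq> supp n g" "W \<subseteq> supp n g" "V \<subseteq> {1..n}" "W \<subseteq> {1..n}"
        using assms big_subset by (auto simp: big_def big_part_def)
      have "?Q = PiE {1..n} F"
      proof (intro equalityI subsetI)
        fix w assume w: "w \<in> ?Q"
        then have w': "w \<in> X" "\<And>a. a \<in> {1..n} \<Longrightarrow> x a \<noteq> w a \<longleftrightarrow> a \<in> supp n g"
          by (auto simp: sphere_iff)
        have "w a \<in> F a" if a: "a \<in> {1..n}" for a
          using w w'(2)[OF a] in_U[OF w'(1) a] a VW by (auto simp: F_def differ_def)
        then show "w \<in> PiE {1..n} F"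
          using w'(1) by (auto simp: points_def PiE_def)
      next
        fix w assume w: "w \<in> PiE {1..n} F"
        have wF: "w a \<in> F a" if "a \<in> {1..n}" for a using w that by auto
        have "F a \<subseteq> U a" if "a \<in> {1..n}" for a
          using that yz in_U by (auto simp: F_def)
        then have "w \<in> X" using w PiE_mono[of "{1..n}" F U] unfolding points_def by blast
        moreover have "x a \<noteq> w a \<longleftrightarrow> a \<in> supp n g" if a: "a \<in> {1..n}" for a
          using wF[OF a] yz(1,2) a VW unfolding sphere_iff by (auto simp: F_def split: if_splits)
        ultimately have "w \<in> sphere" by (simp add: sphere_iff)
        moreover have "a \<in> V" if "a \<in> {1..n}" "y a \<noteq> w a" for a
          using wF[OF that(1)] that(2) by (auto simp: F_def split: if_splits)
        then have "differ y w \<subseteq> V"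
          unfolding differ_def by blast
        moreover have "a \<in> W" if "a \<in> {1..n}" "w a \<noteq> z a" for a
        proof (rule ccontr)
          assume "a \<notin> W"
          then have "a \<notin> V" "w a = y a"
            using wF[OF that(1)] that(2) by (auto simp: F_def split: if_splits)
          then have "a \<in> differ y z" "a \<notin> V \<union> W"
            using that \<open>a \<notin> W\<close> by (auto simp: differ_def)
          then show False using sub by blast
        qed
        then have "differ w z \<subseteq> W"
          unfolding differ_def by blast
        ultimately show "w \<in> ?Q" by simp
      qed
      then have "card ?Q = (\<Prod>a\<in>{1..n}. card (F a))"
        by (simp add: card_PiE)
      also have "\<dots> = (\<Prod>a\<in>V \<inter> W. card (U a) - 1)"
      proof (rule prod.mono_neutral_cong_right)
        fix a assume a: "a \<in> V \<inter> W"
        then have "x a \<in> U a" using VW x_point in_U by blast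
        then show "card (F a) = card (U a) - 1" using a by (simp add: F_def)
      qed (use VW in \<open>auto simp: F_def\<close>)
      finally show ?thesis using sub by (simp only: if_True)
    qed
    finally show ?thesis using yz by (simp add: mat_scale_def basis_mat_def)
  qed (auto simp: mat_algebra_simps mat_scale_def basis_mat_def)
qed

lemma Estar_eq_basis_mat: "Estar n U x g = basis_mat {}"
proof (intro ext)
  fix y z
  have "y = z \<and> (x, y) \<in> R_rel n U g \<longleftrightarrow> y \<in> sphere \<and> z \<in> sphere \<and> differ y z = {}"
    using differ_empty_iff[of y z] sphere_subset by (auto simp: sphere_def R_rel_def)
  then show "Estar n U x g y z = (basis_mat {} y z :: 'a)"
    by (simp add: Estar_def basis_mat_def)
qed

lemma join_algebra_corner:
  "join_algebra mat_scale (corner_algebra n U x g :: ('f::field, (nat \<Rightarrow> 'u, 'f) matrix) module)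
     big (\<lambda>a. of_nat (card (U a) - 1)) basis_mat"
proof -
  interpret vector_space "mat_scale :: 'f \<Rightarrow> (nat \<Rightarrow> 'u, 'f) matrix \<Rightarrow> (nat \<Rightarrow> 'u, 'f) matrix"
    by (rule vector_space_mat_scale)
  let ?A = "corner_algebra n U x g :: ('f, (nat \<Rightarrow> 'u, 'f) matrix) module"
  have mult: "M \<otimes>\<^bsub>?A\<^esub> N = M \<otimes>\<^bsub>mat_algebra X\<^esub> N" for M N
    by (simp add: corner_algebra_def)
  show ?thesis
  proof
    show "carrier ?A = span (basis_mat ` Pow big)"
      by (simp add: carrier_corner_eq_sphere_mat range_sphere_mat)
    show "\<one>\<^bsub>?A\<^esub> = basis_mat {}"
      by (simp add: corner_algebra_def Estar_eq_basis_mat)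
    show "\<zero>\<^bsub>?A\<^esub> = 0" "M \<oplus>\<^bsub>?A\<^esub> N = M + N" "c \<odot>\<^bsub>?A\<^esub> M = mat_scale c M" for c M N
      by (simp_all add: corner_algebra_def mat_algebra_simps)
  next
    fix c :: "nat set \<Rightarrow> 'f" and V
    assume zero: "(\<Sum>V\<in>Pow big. mat_scale (c V) (basis_mat V)) = (0 :: (nat \<Rightarrow> 'u, 'f) matrix)"
      and V: "V \<subseteq> big"
    have "(\<Sum>V\<in>{V. W \<subseteq> V \<and> V \<subseteq> big}. c V) = 0" if W: "W \<subseteq> big" for W
    proof -
      \<comment> \<open>Every \<open>W \<subseteq> big\<close> occurs as a difference set, so some
        entry of the zero matrix is the superset sum at \<open>W\<close>.\<close>
      obtain y z where yz: "y \<in> sphere" "z \<in> sphere" "differ y z = W"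
        using ex_differ_eq[OF W] by blast
      have "sphere_mat (\<lambda>W. \<Sum>V\<in>{V. W \<subseteq> V \<and> V \<subseteq> big}. c V) y z = 0"
        using zero unfolding sum_basis_mat by simp
      then show ?thesis using yz by (simp add: sphere_mat_def)
    qed
    then show "c V = 0" using superset_sums_zero[OF finite_big _ V] by blast
  qed (simp_all add: mult mat_mult_assoc mat_mult_distrib mat_mult_scale basis_mat_mult finite_big)
qed

text \<open>With equal outer entries the symmetric difference is empty, so \<open>P_set\<close> only
  demands a support inside \<open>big\<close>; and in a field \<open>k_val\<close> becomes zero iff
  one of its factors does.\<close>

lemma I_ideal_generators:
  "{B_mat n U x g a g | a. (g, a, g) \<in> P_set n U \<and> of_nat (k_val n U a) = (0::'f::field)} =
   basis_mat ` {V. V \<subseteq> big \<and> V \<inter> {a \<in> big. of_nat (card (U a) - 1) = (0::'f)} \<noteq> {}}"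
proof -
  have P: "(g, a, g) \<in> P_set n U \<longleftrightarrow> a \<in> E_set n \<and> supp n a \<subseteq> big" for a
    using g_E by (auto simp: P_set_def big_def)
  have k: "of_nat (k_val n U a) = (0::'f) \<longleftrightarrow> (\<exists>i\<in>supp n a. of_nat (card (U i) - 1) = (0::'f))" for a
    unfolding k_val_def of_nat_prod by (subst prod_zero_iff) (auto simp: supp_def)
  show ?thesis
  proof (intro equalityI subsetI)
    fix M assume "M \<in> {B_mat n U x g a g | a. (g, a, g) \<in> P_set n U \<and> of_nat (k_val n U a) = (0::'f)}"
    then obtain a where "M = basis_mat (supp n a)" "supp n a \<subseteq> big"
      "\<exists>i\<in>supp n a. of_nat (card (U i) - 1) = (0::'f)"
      unfolding P k B_mat_eq_basis_mat by blast
    then show "M \<in> basis_mat ` {V. V \<subseteq> big \<and> V \<inter> {a \<in> big. of_nat (card (U a) - 1) = (0::'f)} \<noteq> {}}"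
      by blast
  next
    fix M assume "M \<in> basis_mat ` {V. V \<subseteq> big \<and> V \<inter> {a \<in> big. of_nat (card (U a) - 1) = (0::'f)} \<noteq> {}}"
    then obtain V where V: "M = basis_mat V" "V \<subseteq> big" "\<exists>i\<in>V. of_nat (card (U i) - 1) = (0::'f)"
      by blast
    then have "V \<subseteq> {1..n}" using big_subset by blast
    note a = supp_indicator[OF this]
    show "M \<in> {B_mat n U x g a g | a. (g, a, g) \<in> P_set n U \<and> of_nat (k_val n U a) = (0::'f)}"
      unfolding P k B_mat_eq_basis_mat mem_Collect_eq using V a by metis
  qed
qed

end

theorem theorem5p15:
  fixes n :: nat and U :: "nat \<Rightarrow> 'u set" and x :: "nat \<Rightarrow> 'u" and g :: "nat \<Rightarrow> nat"
  assumes "n \<ge> 1"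
    and "\<And>h. h \<in> {1..n} \<Longrightarrow> finite (U h)"
    and "\<And>h. h \<in> {1..n} \<Longrightarrow> card (U h) \<ge> 2"
    and "x \<in> points n U"
    and "g \<in> E_set n"
  shows "let A = (corner_algebra n U x g :: ('f::field, (nat \<Rightarrow> 'u, 'f) matrix) module);
             I = I_ideal n U x g;
             N = 2 ^ card {a \<in> supp n g. card (U a) > 2 \<and> of_nat (card (U a) - 1) \<noteq> (0::'f)}
         in ideal I A
          \<and> algebra_isomorphic (quotient_algebra A I)
              (direct_sum_copies N (mat_algebra (UNIV :: unit set)))
          \<and> jacobson_radical A = I
          \<and> nilpotent_ideal A (jacobson_radical A)
          \<and> nilpotent_index A (jacobson_radical A)
              = card {a \<in> supp n g. of_nat (card (U a) - 1) = (0::'f)} + 1"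
proof -
  interpret H: hamming_corner n U x g
    using assms(2-5) by (rule hamming_corner.intro)
  interpret J: join_algebra mat_scale "corner_algebra n U x g :: ('f, (nat \<Rightarrow> 'u, 'f) matrix) module"
    H.big "\<lambda>a. of_nat (card (U a) - 1)" H.basis_mat
    by (rule H.join_algebra_corner)
  have I: "I_ideal n U x g = J.nil_ideal"
    unfolding I_ideal_def J.nil_ideal_def J.nil_part_def H.I_ideal_generators ..
  have unit: "J.unit_part = {a \<in> supp n g. card (U a) > 2 \<and> of_nat (card (U a) - 1) \<noteq> (0::'f)}"
    unfolding J.unit_part_def unfolding H.big_def big_part_def by blast
  \<comment> \<open>For \<open>card (U a) = 2\<close> the number in question is \<open>1\<close>,
    which is nonzero in a field. Hence a coordinate of \<open>supp n g\<close> where it vanishes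
    lies in \<open>big\<close>.\<close>
  have "card (U a) > 2" if a: "a \<in> supp n g" "of_nat (card (U a) - 1) = (0::'f)" for a
  proof -
    have "card (U a) \<ge> 2" using a assms(3) by (simp add: supp_def)
    moreover have "card (U a) \<noteq> 2" using a(2) by auto
    ultimately show ?thesis by simp
  qed
  then have nil: "J.nil_part = {a \<in> supp n g. of_nat (card (U a) - 1) = (0::'f)}"
    unfolding J.nil_part_def unfolding H.big_def big_part_def by blast
  show ?thesis
    unfolding Let_def I J.jacobson_radical_eq_nil_ideal unit[symmetric] nil[symmetric]
    by (intro conjI J.ideal_nil_ideal J.quotient_nil_ideal_isomorphic refl
        J.nilpotent_nil_ideal J.nilpotent_index_nil_ideal)
qed

end
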